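(* Let $K/F$ be a cyclic Galois field extension of degree $n$ with ${\rm Gal}(K/F)=\langle\sigma\rangle$, let $R=K[t;\sigma]$ and $x=t^n$, and let $N$ be the reduced norm of the central simple $F(x)$-algebra $K(t;\sigma)$. Let $f\in R$ be a monic polynomial of degree $m$ with $(f,t)_r=1$, let $h(t)=\hat h(t^n)$ with $\hat h\in F[x]$ monic be its minimal central left multiple, and suppose that $\deg(\hat h)=m$ (degree in $x$). (i) If $N(f)=\hat h_1\cdots\hat h_l$ such that $\hat h_i\in F[x]$ is irreducible for $1\le i\le l$, then there exists a decomposition $f=f_1\cdots f_l$ of $f$ into irreducible factors such that $N(f_i)=\hat h_i$ for all $i$, $1\le i\le l$. The degree of $f_i$ in $R$ equals the degree of $\hat h_i$ in $F[x]$ for all $i$. (ii) Assume that $N(f)$ is the product of $l$ distinct irreducible factors $\hat h_1,\dots,\hat h_l$ in $F[x]$. Then $f$ has exactly $l!$ irreducible decompositions (decompositions into irreducible factors in $R$), corresponding to each possible ordering of the factors of $N(f)$.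
   Context: $K[t;\sigma]$ is the skew polynomial ring of polynomials $\sum a_it^i$, $a_i\in K$, with $ta=\sigma(a)t$ for $a\in K$. Its center is $C(R)=F[x]$, $x=t^n$. The ring of central quotients $K(t;\sigma)=\{f/g : f\in R,\ 0\neq g\in F[x]\}$ is a central simple algebra of degree $n$ over $F(x)$ (the cyclic algebra $\bigoplus_{i=0}^{n-1}K(x)t^i$, $t^n=x$), and $N$ is its reduced norm; for $f\in R$ one has $N(f)\in F[x]$. An element $f$ of $R$ is irreducible if it is not a unit and is not a product $gq$ with $g,q\in R$ and $1\le\deg g,\deg q<\deg f$. $(f,t)_r$ is the greatest common right divisor of $f$ and $t$. The minimal central left multiple of $f$ is the unique polynomial $h\in C(R)$ of minimal degree such that $h=gf$ for some $g\in R$ and $h(t)=\hat h(t^n)$ with $\hat h\in F[x]$ monic (it exists when $(f,t)_r=1$).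
   Formalization: In (i), N(f_i) equals ĥ_i up to a nonzero constant of F, and exactly if each leading coefficient of ĥ_i is (-1)^((n-1)deg ĥ_i) times a norm from K; in (ii), "distinct" means pairwise non-associated, N(f_i) matches up to constants, and decompositions are counted with monic factors. *)

theory Defs
  imports "Jordan_Normal_Form.Char_Poly"
begin

section \<open>Cyclic Galois extensions\<close>

text \<open>
  A field extension $K/F$ is an embedding \<open>\<iota>\<close> of the field \<open>'f\<close> into the field \<open>'k\<close>.
\<close>

definition galois_group :: "('f::field \<Rightarrow> 'k::field) \<Rightarrow> ('k \<Rightarrow> 'k) set" where
  "galois_group \<iota> = {\<tau>. field_isom \<tau> \<and> (\<forall>a. \<tau> (\<iota> a) = \<iota> a)}"

definition extension_degree :: "('f::field \<Rightarrow> 'k::field) \<Rightarrow> nat" where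
  "extension_degree \<iota> = vector_space.dim (\<lambda>c v. \<iota> c * v) UNIV"

text \<open>
  A finite extension is Galois iff the fixed field of its automorphism group is $F$, equivalently
  iff this group has $[K:F]$ elements; both usual forms are listed. The condition \<open>0 < n\<close> excludes
  infinite extensions, whose \<open>dim\<close> is 0. As the group is finite, the powers of \<open>\<sigma>\<close> with
  exponents in the natural numbers are all of the subgroup generated by \<open>\<sigma>\<close>.
\<close>

definition cyclic_galois_extension ::
  "('f::field \<Rightarrow> 'k::field) \<Rightarrow> ('k \<Rightarrow> 'k) \<Rightarrow> nat \<Rightarrow> bool" where
  "cyclic_galois_extension \<iota> \<sigma> n \<longleftrightarrow>
     field_hom \<iota> \<and> 0 < n \<and> extension_degree \<iota> = n \<and>
     card (galois_group \<iota>) = n \<and>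
     {a. \<forall>\<tau>\<in>galois_group \<iota>. \<tau> a = a} = range \<iota> \<and>
     galois_group \<iota> = range (\<lambda>i. \<sigma> ^^ i)"

text \<open>
  $N_{K/F}(c)$. If \<open>p\<close> has degree $d$ and leading coefficient $c$, its reduced norm below has degree
  $d$ and leading coefficient $(-1)^{(n-1)d} N_{K/F}(c)$. Hence a given factor in $F[x]$ can in
  general be the norm of a factor of \<open>p\<close> only up to a constant.
\<close>

definition galois_norm :: "('k::field \<Rightarrow> 'k) \<Rightarrow> nat \<Rightarrow> 'k \<Rightarrow> 'k" where
  "galois_norm \<sigma> n c = (\<Prod>i<n. (\<sigma> ^^ i) c)"


section \<open>The skew polynomial ring $K[t;\sigma]$\<close>

text \<open>
  The elements are those of \<open>'k poly\<close>, a polynomial with coefficients $a_i$ standing for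
  $\sum a_i t^i$; addition, degree and coefficients are the ones of \<open>'k poly\<close>, so that only the
  multiplication, which has $ta = \sigma(a)t$, is new. The variable $t$ is \<open>monom 1 1\<close>.
\<close>

definition skew_mult :: "('k::field \<Rightarrow> 'k) \<Rightarrow> 'k poly \<Rightarrow> 'k poly \<Rightarrow> 'k poly" where
  "skew_mult \<sigma> p q =
     (\<Sum>i\<le>degree p. \<Sum>j\<le>degree q. monom (coeff p i * (\<sigma> ^^ i) (coeff q j)) (i + j))"

definition skew_prod :: "('k::field \<Rightarrow> 'k) \<Rightarrow> 'k poly list \<Rightarrow> 'k poly" where
  "skew_prod \<sigma> fs = foldr (skew_mult \<sigma>) fs 1"

definition skew_unit :: "('k::field \<Rightarrow> 'k) \<Rightarrow> 'k poly \<Rightarrow> bool" where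
  "skew_unit \<sigma> p \<longleftrightarrow> (\<exists>q. skew_mult \<sigma> p q = 1 \<and> skew_mult \<sigma> q p = 1)"

definition skew_irreducible :: "('k::field \<Rightarrow> 'k) \<Rightarrow> 'k poly \<Rightarrow> bool" where
  "skew_irreducible \<sigma> p \<longleftrightarrow> p \<noteq> 0 \<and> \<not> skew_unit \<sigma> p \<and>
     \<not> (\<exists>g q. p = skew_mult \<sigma> g q \<and> 1 \<le> degree g \<and> degree g < degree p \<and>
              1 \<le> degree q \<and> degree q < degree p)"

definition right_divides :: "('k::field \<Rightarrow> 'k) \<Rightarrow> 'k poly \<Rightarrow> 'k poly \<Rightarrow> bool" where
  "right_divides \<sigma> d p \<longleftrightarrow> (\<exists>g. p = skew_mult \<sigma> g d)"

definition is_gcrd :: "('k::field \<Rightarrow> 'k) \<Rightarrow> 'k poly \<Rightarrow> 'k poly \<Rightarrow> 'k poly \<Rightarrow> bool" where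
  "is_gcrd \<sigma> p q d \<longleftrightarrow> lead_coeff d = 1 \<and> right_divides \<sigma> d p \<and> right_divides \<sigma> d q \<and>
     (\<forall>e. right_divides \<sigma> e p \<and> right_divides \<sigma> e q \<longrightarrow> right_divides \<sigma> e d)"

definition skew_center :: "('k::field \<Rightarrow> 'k) \<Rightarrow> 'k poly set" where
  "skew_center \<sigma> = {z. \<forall>p. skew_mult \<sigma> z p = skew_mult \<sigma> p z}"

text \<open>
  The element $\hat h(t^n)$ of $R$ for $\hat h \in F[x]$. The powers of $t$ multiply as in the
  commutative polynomial ring, so this is an ordinary substitution.
\<close>

definition eval_at_tn :: "('f::field \<Rightarrow> 'k::field) \<Rightarrow> nat \<Rightarrow> 'f poly \<Rightarrow> 'k poly" where
  "eval_at_tn \<iota> n h = pcompose (map_poly \<iota> h) (monom 1 n)"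

definition min_central_left_multiple ::
  "('k::field \<Rightarrow> 'k) \<Rightarrow> 'k poly \<Rightarrow> 'k poly \<Rightarrow> bool" where
  "min_central_left_multiple \<sigma> f h \<longleftrightarrow>
     h \<in> skew_center \<sigma> \<and> h \<noteq> 0 \<and> right_divides \<sigma> f h \<and>
     (\<forall>h'\<in>skew_center \<sigma>. h' \<noteq> 0 \<and> right_divides \<sigma> f h' \<longrightarrow> degree h \<le> degree h')"

text \<open>
  Units can be moved between neighbouring factors; each class of decompositions of a monic
  polynomial up to this has exactly one representative with monic factors.
\<close>

definition monic_irreducible_decompositions ::
  "('k::field \<Rightarrow> 'k) \<Rightarrow> 'k poly \<Rightarrow> 'k poly list set" where
  "monic_irreducible_decompositions \<sigma> f =
     {fs. (\<forall>g\<in>set fs. lead_coeff g = 1 \<and> skew_irreducible \<sigma> g) \<and> f = skew_prod \<sigma> fs}"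


section \<open>The cyclic algebra $K(t;\sigma)$ and its reduced norm\<close>

text \<open>The map on rational function fields that a field embedding induces on coefficients.\<close>

definition fract_map :: "('a::field \<Rightarrow> 'b::field) \<Rightarrow> 'a poly fract \<Rightarrow> 'b poly fract" where
  "fract_map \<phi> q = (THE r. \<exists>a b. b \<noteq> 0 \<and> q = Fract a b \<and>
     r = Fract (map_poly \<phi> a) (map_poly \<phi> b))"

definition fract_X :: "'k::field poly fract" where
  "fract_X = to_fract (monom 1 1)"

text \<open>
  The elements of $K(t;\sigma) = \bigoplus_{i<n} K(x)t^i$ are the vectors in \<open>carrier_vec n\<close> of
  their coordinates in $K(x)$. The product is determined by
  $at^i \cdot bt^j = a\sigma^i(b)\, x^{(i+j)\,\mathrm{div}\,n}\, t^{(i+j)\bmod n}$, where \<open>\<sigma>\<close> acts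
  on $K(x)$ with $\sigma(x) = x$.
\<close>

definition cyc_mult :: "nat \<Rightarrow> ('k::field \<Rightarrow> 'k) \<Rightarrow>
    'k poly fract vec \<Rightarrow> 'k poly fract vec \<Rightarrow> 'k poly fract vec" where
  "cyc_mult n \<sigma> a b = vec n (\<lambda>k. \<Sum>i<n. \<Sum>j<n.
     if (i + j) mod n = k
     then a $ i * (fract_map \<sigma> ^^ i) (b $ j) * fract_X ^ ((i + j) div n) else 0)"

definition cyc_embed :: "nat \<Rightarrow> 'k::field poly \<Rightarrow> 'k poly fract vec" where
  "cyc_embed n f = vec n (\<lambda>i. \<Sum>j\<le>degree f.
     if j mod n = i then to_fract (monom (coeff f j) (j div n)) else 0)"

text \<open>
  The field $K(x)$ is a maximal subfield of $A = K(t;\sigma)$ and splits it: $A$ is a left vector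
  space over $K(x)$ with basis $1,t,\dots,t^{n-1}$, and right multiplication by $a$ is
  $K(x)$-linear with matrix \<open>cyc_rep n \<sigma> a\<close>, acting on row vectors. This is a unital homomorphism
  of $F(x)$-algebras $A \to M_n(K(x))$ (proved below), which induces
  $A \otimes_{F(x)} K(x) \cong M_n(K(x))$ because $A$ is central simple of degree $n$. The reduced
  norm of $a$ is the element of $F(x)$ that the determinant of the image of $a$ under such a
  splitting equals; it does not depend on the splitting.
\<close>

definition cyc_rep :: "nat \<Rightarrow> ('k::field \<Rightarrow> 'k) \<Rightarrow> 'k poly fract vec \<Rightarrow> 'k poly fract mat" where
  "cyc_rep n \<sigma> a = mat n n (\<lambda>(i, k). cyc_mult n \<sigma> (unit_vec n i) a $ k)"

definition reduced_norm :: "('f::field \<Rightarrow> 'k::field) \<Rightarrow> ('k \<Rightarrow> 'k) \<Rightarrow> nat \<Rightarrow>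
    'k poly fract vec \<Rightarrow> 'f poly fract" where
  "reduced_norm \<iota> \<sigma> n a = (THE r. fract_map \<iota> r = det (cyc_rep n \<sigma> a))"

text \<open>The reduced norm of an element of $R$, which lies in $F[x]$.\<close>

definition skew_norm :: "('f::field \<Rightarrow> 'k::field) \<Rightarrow> ('k \<Rightarrow> 'k) \<Rightarrow> nat \<Rightarrow>
    'k poly \<Rightarrow> 'f poly" where
  "skew_norm \<iota> \<sigma> n f = (THE p. to_fract p = reduced_norm \<iota> \<sigma> n (cyc_embed n f))"


section \<open>The splitting representation\<close>

lemma fract_map_Fract:
  assumes "field_hom \<phi>" "b \<noteq> 0"
  shows "fract_map \<phi> (Fract a b) = Fract (map_poly \<phi> a) (map_poly \<phi> b)"
proof -
  interpret field_hom \<phi> by fact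
  interpret mp: map_poly_inj_idom_hom \<phi> ..
  show ?thesis unfolding fract_map_def
  proof (rule the_equality)
    show "\<exists>a' b'. b' \<noteq> 0 \<and> Fract a b = Fract a' b' \<and>
        Fract (map_poly \<phi> a) (map_poly \<phi> b) = Fract (map_poly \<phi> a') (map_poly \<phi> b')"
      using assms(2) by blast
  next
    fix r assume "\<exists>a' b'. b' \<noteq> 0 \<and> Fract a b = Fract a' b' \<and>
        r = Fract (map_poly \<phi> a') (map_poly \<phi> b')"
    then obtain a' b' where b': "b' \<noteq> 0" and eq: "Fract a b = Fract a' b'"
      and r: "r = Fract (map_poly \<phi> a') (map_poly \<phi> b')" by blast
    have "a * b' = a' * b" using eq assms(2) b' by (simp add: eq_fract)
    then have "map_poly \<phi> a * map_poly \<phi> b' = map_poly \<phi> a' * map_poly \<phi> b"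
      by (metis mp.hom_mult)
    then show "r = Fract (map_poly \<phi> a) (map_poly \<phi> b)"
      using r assms(2) b' by (simp add: eq_fract)
  qed
qed

lemma field_hom_fract_map:
  assumes "field_hom \<phi>"
  shows "field_hom (fract_map \<phi>)"
proof -
  interpret field_hom \<phi> by fact
  interpret mp: map_poly_inj_idom_hom \<phi> ..
  note F = fract_map_Fract[OF assms]
  show ?thesis
  proof
    show "fract_map \<phi> 0 = 0" by (simp add: Zero_fract_def F)
    show "fract_map \<phi> 1 = 1" by (simp add: One_fract_def F)
    fix x y :: "'a poly fract"
    obtain a b where x: "x = Fract a b" "b \<noteq> 0" by (cases x)
    obtain c d where y: "y = Fract c d" "d \<noteq> 0" by (cases y)
    show "fract_map \<phi> (x + y) = fract_map \<phi> x + fract_map \<phi> y"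
      using x y by (simp add: F mp.hom_add mp.hom_mult)
    show "fract_map \<phi> (x * y) = fract_map \<phi> x * fract_map \<phi> y"
      using x y by (simp add: F mp.hom_mult)
  qed
qed

lemma field_hom_funpow:
  fixes \<phi> :: "'a::field \<Rightarrow> 'a"
  assumes "field_hom \<phi>"
  shows "field_hom (\<phi> ^^ i)"
proof (induction i)
  case 0
  show ?case by unfold_locales auto
next
  case (Suc i)
  interpret field_hom \<phi> by fact
  interpret i: field_hom "\<phi> ^^ i" by (rule Suc)
  show ?case by unfold_locales (simp_all add: hom_add hom_mult i.hom_add i.hom_mult)
qed

lemma fract_map_funpow_Fract:
  fixes \<sigma> :: "'k::field \<Rightarrow> 'k"
  assumes "field_hom \<sigma>" "b \<noteq> 0"
  shows "(fract_map \<sigma> ^^ i) (Fract a b) = Fract (map_poly (\<sigma> ^^ i) a) (map_poly (\<sigma> ^^ i) b)"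
proof (induction i)
  case (Suc i)
  interpret field_hom "\<sigma> ^^ i" by (rule field_hom_funpow[OF assms(1)])
  interpret mp: map_poly_inj_idom_hom "\<sigma> ^^ i" ..
  interpret s: field_hom \<sigma> by fact
  show ?case
    using assms(2) by (simp add: Suc fract_map_Fract[OF assms(1)] map_poly_map_poly o_def)
qed (use assms in \<open>simp add: map_poly_id'\<close>)

lemma cyclic_galois_field_hom:
  assumes "cyclic_galois_extension \<iota> \<sigma> n"
  shows "field_hom \<sigma>" "bij \<sigma>" "\<sigma> (\<iota> a) = \<iota> a"
proof -
  have "\<sigma> ^^ 1 \<in> galois_group \<iota>" using assms unfolding cyclic_galois_extension_def by blast
  then have s: "field_isom \<sigma>" "\<And>a. \<sigma> (\<iota> a) = \<iota> a" by (auto simp: galois_group_def)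
  then show "\<sigma> (\<iota> a) = \<iota> a" by blast
  interpret field_isom \<sigma> by fact
  show "field_hom \<sigma>" ..
  show "bij \<sigma>" by (metis bijI injI injectivity surjI surjective.surj surjective_axioms)
qed

lemma cyclic_galois_funpow_n:
  assumes "cyclic_galois_extension \<iota> \<sigma> n"
  shows "\<sigma> ^^ n = id"
proof -
  have bij: "bij \<sigma>" using cyclic_galois_field_hom[OF assms] by blast
  have fin: "finite (range (\<lambda>i. \<sigma> ^^ i))" and cd: "card (range (\<lambda>i. \<sigma> ^^ i)) = n" and n: "0 < n"
    using assms unfolding cyclic_galois_extension_def by (auto intro: card_ge_0_finite)
  have cancel: "\<sigma> ^^ (j - i) = id" if "i \<le> j" "\<sigma> ^^ i = \<sigma> ^^ j" for i j
  proof -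
    have "\<sigma> ^^ i \<circ> \<sigma> ^^ (j - i) = \<sigma> ^^ i \<circ> id"
      using that by (metis comp_id funpow_add le_add_diff_inverse)
    moreover have "inj (\<sigma> ^^ i)" using bij by (simp add: bij_is_inj inj_fn)
    ultimately show ?thesis by (metis fun.inj_map_strong inj_eq comp_apply ext)
  qed
  have "\<not> inj (\<lambda>i. \<sigma> ^^ i)" using fin by (metis finite_imageD infinite_UNIV_nat)
  then obtain i j where "i < j" "\<sigma> ^^ i = \<sigma> ^^ j"
    by (metis injI nat_neq_iff)
  then have ex: "\<exists>r>0. \<sigma> ^^ r = id" using cancel[of i j] by (intro exI[of _ "j - i"]) simp
  define r where "r = (LEAST r. r > 0 \<and> \<sigma> ^^ r = id)"
  have r: "r > 0" "\<sigma> ^^ r = id" using LeastI_ex[OF ex] by (auto simp: r_def)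
  have least: "s = 0" if "s < r" "\<sigma> ^^ s = id" for s
    using not_less_Least[of s "\<lambda>r. r > 0 \<and> \<sigma> ^^ r = id"] that by (auto simp: r_def)
  have "\<sigma> ^^ i = \<sigma> ^^ (i mod r)" for i
  proof -
    have "\<sigma> ^^ (r * (i div r)) = id" by (simp add: funpow_mult[symmetric] r)
    then have "\<sigma> ^^ (i mod r + r * (i div r)) = \<sigma> ^^ (i mod r)" by (simp only: funpow_add comp_id)
    then show ?thesis by (simp only: mod_mult_div_eq)
  qed
  then have "range (\<lambda>i. \<sigma> ^^ i) = (\<lambda>i. \<sigma> ^^ i) ` {..<r}"
    using r by (auto intro!: image_eqI[where x = "_ mod r"])
  moreover have "inj_on (\<lambda>i. \<sigma> ^^ i) {..<r}"
  proof (rule linorder_inj_onI)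
    fix i j assume "i < j" "i \<in> {..<r}" "j \<in> {..<r}"
    then show "\<sigma> ^^ i \<noteq> \<sigma> ^^ j" using cancel[of i j] least[of "j - i"] by force
  qed auto
  ultimately have "r = n" using cd by (simp add: card_image)
  then show ?thesis using r by simp
qed

lemma fract_map_funpow_n:
  assumes "cyclic_galois_extension \<iota> \<sigma> n"
  shows "(fract_map \<sigma> ^^ n) q = q"
proof -
  obtain a b where "q = Fract a b" "b \<noteq> 0" by (cases q)
  then show ?thesis
    by (simp add: fract_map_funpow_Fract cyclic_galois_field_hom[OF assms]
        cyclic_galois_funpow_n[OF assms] map_poly_id)
qed

lemma fract_map_funpow_mod:
  assumes "cyclic_galois_extension \<iota> \<sigma> n"
  shows "(fract_map \<sigma> ^^ (i mod n)) q = (fract_map \<sigma> ^^ i) q"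
proof -
  have n: "fract_map \<sigma> ^^ n = id" using fract_map_funpow_n[OF assms] by auto
  have "fract_map \<sigma> ^^ (n * (i div n)) = id" by (simp add: funpow_mult[symmetric] n)
  then have "fract_map \<sigma> ^^ (i mod n + n * (i div n)) = fract_map \<sigma> ^^ (i mod n)"
    by (simp only: funpow_add comp_id)
  then show ?thesis by (simp only: mod_mult_div_eq)
qed

lemma fract_map_funpow_X:
  fixes \<sigma> :: "'k::field \<Rightarrow> 'k"
  assumes "field_hom \<sigma>"
  shows "(fract_map \<sigma> ^^ i) fract_X = fract_X"
proof -
  interpret field_hom "\<sigma> ^^ i" by (rule field_hom_funpow[OF assms])
  show ?thesis
    by (simp add: fract_X_def to_fract_def fract_map_funpow_Fract[OF assms] map_poly_monom)
qed

lemma fract_map_funpow_base: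
  assumes "cyclic_galois_extension \<iota> \<sigma> n"
  shows "(fract_map \<sigma> ^^ i) (fract_map \<iota> c) = fract_map \<iota> c"
proof -
  have i: "field_hom \<iota>" using assms by (simp add: cyclic_galois_extension_def)
  interpret field_hom \<iota> by fact
  interpret mp: map_poly_inj_idom_hom \<iota> ..
  obtain a b where c: "c = Fract a b" "b \<noteq> 0" by (cases c)
  note s = cyclic_galois_field_hom[OF assms]
  interpret s: field_hom \<sigma> by (rule s)
  have "map_poly \<sigma> (map_poly \<iota> p) = map_poly \<iota> p" for p
    by (rule poly_eqI) (simp add: coeff_map_poly s)
  then have "fract_map \<sigma> (fract_map \<iota> c) = fract_map \<iota> c"
    using c by (simp add: fract_map_Fract i s)
  then show ?thesis by (induction i) auto
qed

lemma cyc_mult_assoc: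
  assumes "cyclic_galois_extension \<iota> \<sigma> n"
  shows "cyc_mult n \<sigma> (cyc_mult n \<sigma> a b) c = cyc_mult n \<sigma> a (cyc_mult n \<sigma> b c)"
proof (rule eq_vecI)
  have n: "0 < n" using assms by (simp add: cyclic_galois_extension_def)
  note s = cyclic_galois_field_hom(1)[OF assms]
  define S where "S i = fract_map \<sigma> ^^ i" for i
  have hom: "field_hom (S i)" for i
    unfolding S_def by (intro field_hom_funpow field_hom_fract_map s)
  interpret S: field_hom "S i" for i by (rule hom)
  have X: "S i fract_X = fract_X" for i by (simp add: S_def fract_map_funpow_X s)
  have Smod: "S (i mod n) q = S i q" for i q by (simp add: S_def fract_map_funpow_mod[OF assms])
  have Sadd: "S i (S j q) = S (i + j) q" for i j q by (simp add: S_def funpow_add)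
  have divs: "(i + j) div n + ((i + j) mod n + l) div n = (i + j + l) div n" for i j l
  proof -
    have "i + j + l = ((i + j) mod n + l) + (i + j) div n * n"
      using mod_div_mult_eq[of "i + j" n] by linarith
    then have "(i + j + l) div n = (((i + j) mod n + l) + (i + j) div n * n) div n" by (rule arg_cong)
    also have "\<dots> = (i + j) div n + ((i + j) mod n + l) div n" using n by (simp only: div_mult_self1 neq0_conv)
    finally show ?thesis by (rule sym)
  qed
  have divs': "(j + l) div n + (i + (j + l) mod n) div n = (i + (j + l)) div n" for i j l
    using divs[of j l i] by (simp add: ac_simps)
  define T where "T k i j l = (if (i + j + l) mod n = k
    then a $ i * S i (b $ j) * S (i + j) (c $ l) * fract_X ^ ((i + j + l) div n) else 0)"
    for k i j l
  fix k assume "k < dim_vec (cyc_mult n \<sigma> a (cyc_mult n \<sigma> b c))"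
  then have k: "k < n" by (simp add: cyc_mult_def)
  have pick: "(\<Sum>m<n. if e mod n = m then g m else 0) = g (e mod n)" for e and g :: "nat \<Rightarrow> 'b poly fract"
    using n by (simp add: sum.delta)
  have "cyc_mult n \<sigma> (cyc_mult n \<sigma> a b) c $ k =
     (\<Sum>m<n. \<Sum>l<n. if (m + l) mod n = k then (\<Sum>i<n. \<Sum>j<n. if (i + j) mod n = m
        then a $ i * S i (b $ j) * fract_X ^ ((i + j) div n) else 0) * S m (c $ l) *
        fract_X ^ ((m + l) div n) else 0)"
    using k unfolding cyc_mult_def S_def by (auto intro!: sum.cong)
  also have "\<dots> = (\<Sum>m<n. \<Sum>l<n. \<Sum>i<n. \<Sum>j<n. if (i + j) mod n = m then (if (m + l) mod n = k then
        a $ i * S i (b $ j) * fract_X ^ ((i + j) div n) * S m (c $ l) *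
        fract_X ^ ((m + l) div n) else 0) else 0)"
  proof (intro sum.cong refl)
    fix m l
    show "(if (m + l) mod n = k then (\<Sum>i<n. \<Sum>j<n. if (i + j) mod n = m
        then a $ i * S i (b $ j) * fract_X ^ ((i + j) div n) else 0) * S m (c $ l) *
        fract_X ^ ((m + l) div n) else 0) =
      (\<Sum>i<n. \<Sum>j<n. if (i + j) mod n = m then (if (m + l) mod n = k then
        a $ i * S i (b $ j) * fract_X ^ ((i + j) div n) * S m (c $ l) *
        fract_X ^ ((m + l) div n) else 0) else 0)"
      by (cases "(m + l) mod n = k") (auto simp: sum_distrib_right cong: if_cong intro!: sum.cong)
  qed
  also have "\<dots> = (\<Sum>i<n. \<Sum>j<n. \<Sum>l<n. \<Sum>m<n. if (i + j) mod n = m then (if (m + l) mod n = k then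
        a $ i * S i (b $ j) * fract_X ^ ((i + j) div n) * S m (c $ l) *
        fract_X ^ ((m + l) div n) else 0) else 0)"
    (is "?L = ?R")
  proof -
    define h where "h m l i j = (if (i + j) mod n = m then (if (m + l) mod n = k then
        a $ i * S i (b $ j) * fract_X ^ ((i + j) div n) * S m (c $ l) *
        fract_X ^ ((m + l) div n) else 0) else 0)" for m l i j
    have "(\<Sum>m<n. \<Sum>l<n. \<Sum>i<n. \<Sum>j<n. h m l i j) = (\<Sum>m<n. \<Sum>i<n. \<Sum>l<n. \<Sum>j<n. h m l i j)"
      by (intro sum.cong refl sum.swap)
    also have "\<dots> = (\<Sum>i<n. \<Sum>m<n. \<Sum>l<n. \<Sum>j<n. h m l i j)" by (rule sum.swap)
    also have "\<dots> = (\<Sum>i<n. \<Sum>m<n. \<Sum>j<n. \<Sum>l<n. h m l i j)"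
      by (intro sum.cong refl sum.swap)
    also have "\<dots> = (\<Sum>i<n. \<Sum>j<n. \<Sum>m<n. \<Sum>l<n. h m l i j)" by (intro sum.cong refl sum.swap)
    also have "\<dots> = (\<Sum>i<n. \<Sum>j<n. \<Sum>l<n. \<Sum>m<n. h m l i j)" by (intro sum.cong refl sum.swap)
    finally show ?thesis by (simp only: h_def)
  qed
  also have "\<dots> = (\<Sum>i<n. \<Sum>j<n. \<Sum>l<n. T k i j l)"
    unfolding pick T_def
    by (intro sum.cong refl) (simp add: Smod mod_simps divs[symmetric] power_add)
  also have "\<dots> = (\<Sum>i<n. \<Sum>j<n. \<Sum>l<n. \<Sum>m<n. if (j + l) mod n = m then (if (i + m) mod n = k then
        a $ i * (S i (b $ j) * S i (S j (c $ l)) * fract_X ^ ((j + l) div n)) *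
        fract_X ^ ((i + m) div n) else 0) else 0)"
    unfolding pick T_def
    by (intro sum.cong refl) (simp add: Sadd mod_simps add.assoc divs'[symmetric] power_add)
  also have "\<dots> = (\<Sum>i<n. \<Sum>m<n. \<Sum>j<n. \<Sum>l<n. if (j + l) mod n = m then (if (i + m) mod n = k then
        a $ i * (S i (b $ j) * S i (S j (c $ l)) * fract_X ^ ((j + l) div n)) *
        fract_X ^ ((i + m) div n) else 0) else 0)"
  proof -
    define h where "h i j l m = (if (j + l) mod n = m then (if (i + m) mod n = k then
        a $ i * (S i (b $ j) * S i (S j (c $ l)) * fract_X ^ ((j + l) div n)) *
        fract_X ^ ((i + m) div n) else 0) else 0)" for i j l m
    have "(\<Sum>i<n. \<Sum>j<n. \<Sum>l<n. \<Sum>m<n. h i j l m) = (\<Sum>i<n. \<Sum>j<n. \<Sum>m<n. \<Sum>l<n. h i j l m)"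
      by (intro sum.cong refl sum.swap)
    also have "\<dots> = (\<Sum>i<n. \<Sum>m<n. \<Sum>j<n. \<Sum>l<n. h i j l m)"
      by (intro sum.cong refl sum.swap)
    finally show ?thesis by (simp only: h_def)
  qed
  also have "\<dots> = (\<Sum>i<n. \<Sum>m<n. if (i + m) mod n = k then a $ i * S i (\<Sum>j<n. \<Sum>l<n. if (j + l) mod n = m
        then b $ j * S j (c $ l) * fract_X ^ ((j + l) div n) else 0) *
        fract_X ^ ((i + m) div n) else 0)"
  proof (intro sum.cong refl)
    fix i m
    show "(\<Sum>j<n. \<Sum>l<n. if (j + l) mod n = m then (if (i + m) mod n = k then
        a $ i * (S i (b $ j) * S i (S j (c $ l)) * fract_X ^ ((j + l) div n)) *
        fract_X ^ ((i + m) div n) else 0) else 0) =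
      (if (i + m) mod n = k then a $ i * S i (\<Sum>j<n. \<Sum>l<n. if (j + l) mod n = m
        then b $ j * S j (c $ l) * fract_X ^ ((j + l) div n) else 0) *
        fract_X ^ ((i + m) div n) else 0)"
      by (cases "(i + m) mod n = k")
         (auto simp: sum_distrib_right sum_distrib_left S.hom_sum S.hom_mult S.hom_power X
            cong: if_cong intro!: sum.cong)
  qed
  also have "\<dots> = cyc_mult n \<sigma> a (cyc_mult n \<sigma> b c) $ k"
    using k unfolding cyc_mult_def S_def by (auto intro!: sum.cong)
  finally show "cyc_mult n \<sigma> (cyc_mult n \<sigma> a b) c $ k = \<dots>" .
qed (simp add: cyc_mult_def)

lemma cyc_rep_mult:
  assumes "cyclic_galois_extension \<iota> \<sigma> n"
  shows "cyc_rep n \<sigma> (cyc_mult n \<sigma> a b) = cyc_rep n \<sigma> a * cyc_rep n \<sigma> b"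
proof (rule eq_matI)
  have lin: "cyc_mult n \<sigma> v b $ k = (\<Sum>l<n. v $ l * cyc_mult n \<sigma> (unit_vec n l) b $ k)"
    if "k < n" for v k
    using that by (auto simp: cyc_mult_def unit_vec_def sum_distrib_left if_distrib if_distribR
        sum.If_cases intro!: sum.cong)
  fix i k assume "i < dim_row (cyc_rep n \<sigma> a * cyc_rep n \<sigma> b)"
    "k < dim_col (cyc_rep n \<sigma> a * cyc_rep n \<sigma> b)"
  then have ik: "i < n" "k < n" by (simp_all add: cyc_rep_def)
  have "cyc_rep n \<sigma> (cyc_mult n \<sigma> a b) $$ (i, k) =
      cyc_mult n \<sigma> (cyc_mult n \<sigma> (unit_vec n i) a) b $ k"
    using ik by (simp add: cyc_rep_def cyc_mult_assoc[OF assms])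
  also have "\<dots> = (cyc_rep n \<sigma> a * cyc_rep n \<sigma> b) $$ (i, k)"
    using ik by (simp add: lin[of k "cyc_mult n \<sigma> (unit_vec n i) a"] cyc_rep_def scalar_prod_def
        atLeast0LessThan)
  finally show "cyc_rep n \<sigma> (cyc_mult n \<sigma> a b) $$ (i, k) = \<dots>" .
qed (simp_all add: cyc_rep_def)

lemma cyc_rep_add:
  assumes "cyclic_galois_extension \<iota> \<sigma> n" "a \<in> carrier_vec n" "b \<in> carrier_vec n"
  shows "cyc_rep n \<sigma> (a + b) = cyc_rep n \<sigma> a + cyc_rep n \<sigma> b"
proof -
  have "field_hom (fract_map \<sigma> ^^ i)" for i
    by (intro field_hom_funpow field_hom_fract_map cyclic_galois_field_hom[OF assms(1)])
  then interpret S: field_hom "fract_map \<sigma> ^^ i" for i .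
  show ?thesis using assms(2,3)
    by (intro eq_matI) (auto simp: cyc_rep_def cyc_mult_def S.hom_add algebra_simps
        sum.distrib[symmetric] intro!: sum.cong)
qed

lemma cyc_rep_smult:
  assumes "cyclic_galois_extension \<iota> \<sigma> n" "a \<in> carrier_vec n"
  shows "cyc_rep n \<sigma> (fract_map \<iota> c \<cdot>\<^sub>v a) = fract_map \<iota> c \<cdot>\<^sub>m cyc_rep n \<sigma> a"
proof -
  have "field_hom (fract_map \<sigma> ^^ i)" for i
    by (intro field_hom_funpow field_hom_fract_map cyclic_galois_field_hom[OF assms(1)])
  then interpret S: field_hom "fract_map \<sigma> ^^ i" for i .
  show ?thesis using assms(2)
    by (intro eq_matI) (auto simp: cyc_rep_def cyc_mult_def S.hom_mult sum_distrib_left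
        fract_map_funpow_base[OF assms(1)] intro!: sum.cong)
qed

lemma cyc_rep_one:
  assumes "cyclic_galois_extension \<iota> \<sigma> n"
  shows "cyc_rep n \<sigma> (unit_vec n 0) = 1\<^sub>m n"
proof -
  have "field_hom (fract_map \<sigma> ^^ i)" for i
    by (intro field_hom_funpow field_hom_fract_map cyclic_galois_field_hom[OF assms(1)])
  then interpret S: field_hom "fract_map \<sigma> ^^ i" for i .
  have n: "0 < n" using assms by (simp add: cyclic_galois_extension_def)
  have "cyc_mult n \<sigma> (unit_vec n i) (unit_vec n 0) $ k = (if i = k then 1 else 0)"
    if "i < n" "k < n" for i k
  proof -
    have "cyc_mult n \<sigma> (unit_vec n i) (unit_vec n 0) $ k =
      (\<Sum>i'<n. \<Sum>j<n. if j = 0 then (if i' = i then (if i = k then 1 else 0) else 0) else 0)"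
    proof -
      have "cyc_mult n \<sigma> (unit_vec n i) (unit_vec n 0) $ k =
        (\<Sum>i'<n. \<Sum>j<n. if (i' + j) mod n = k then (if i' = i then 1 else 0) *
          (fract_map \<sigma> ^^ i') (if j = 0 then 1 else 0) * fract_X ^ ((i' + j) div n) else 0)"
        using that unfolding cyc_mult_def by (auto intro!: sum.cong)
      also have "\<dots> = (\<Sum>i'<n. \<Sum>j<n. if j = 0 then (if i' = i then (if i = k then 1 else 0) else 0) else 0)"
        using that by (intro sum.cong refl) auto
      finally show ?thesis .
    qed
    also have "\<dots> = (if i = k then 1 else 0)" using that n by (simp add: sum.delta)
    finally show ?thesis .
  qed
  then have "cyc_rep n \<sigma> (unit_vec n 0) = mat n n (\<lambda>(i, k). if i = k then 1 else 0)"
    unfolding cyc_rep_def by (intro cong_mat) auto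
  then show ?thesis by (simp add: one_mat_def)
qed

lemma cyc_embed_mult:
  assumes "cyclic_galois_extension \<iota> \<sigma> n"
  shows "cyc_embed n (skew_mult \<sigma> p q) = cyc_mult n \<sigma> (cyc_embed n p) (cyc_embed n q)"
proof (rule eq_vecI)
  have n: "0 < n" using assms by (simp add: cyclic_galois_extension_def)
  note s = cyclic_galois_field_hom(1)[OF assms]
  interpret s: field_hom "\<sigma> ^^ i" for i by (rule field_hom_funpow) (rule s)
  define S where "S i = fract_map \<sigma> ^^ i" for i
  have hom: "field_hom (S i)" for i
    unfolding S_def by (intro field_hom_funpow field_hom_fract_map s)
  interpret S: field_hom "S i" for i by (rule hom)
  have Smod: "S (i mod n) q = S i q" for i q by (simp add: S_def fract_map_funpow_mod[OF assms])
  define u where "u c j = to_fract (monom c (j div n))" for c :: 'b and j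
  have u0 [simp]: "u 0 j = 0" for j by (simp add: u_def)
  have u_add: "u (c + d) j = u c j + u d j" for c d j
    by (simp only: u_def add_monom[symmetric] to_fract_add)
  have Xpow: "fract_X ^ e = to_fract (monom (1 :: 'b) e)" for e
  proof (induction e)
    case (Suc e)
    have "monom 1 (Suc e) = monom 1 1 * monom (1 :: 'b) e" by (simp add: mult_monom)
    then show ?case by (simp only: power_Suc Suc[unfolded fract_X_def] fract_X_def to_fract_mult)
  qed (simp flip: one_pCons add: monom_0)
  have Su: "S i (u c j) = u ((\<sigma> ^^ i) c) j" for i j c
    by (simp add: S_def u_def to_fract_def fract_map_funpow_Fract[OF s] map_poly_monom)
  have Smod_u: "S (i mod n) (u c j) = u ((\<sigma> ^^ i) c) j" for i j c by (metis Smod Su)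
  have u_mult: "u c i * u d j * fract_X ^ ((i mod n + j mod n) div n) = u (c * d) (i + j)"
    for c d i j
  proof -
    have "i div n + j div n + (i mod n + j mod n) div n = (i + j) div n"
      by (rule div_add1_eq[symmetric])
    then have "monom (c * d) ((i + j) div n) =
        monom c (i div n) * monom d (j div n) * monom 1 ((i mod n + j mod n) div n)"
      by (simp add: mult_monom)
    then show ?thesis by (simp only: u_def Xpow to_fract_mult)
  qed
  fix k assume "k < dim_vec (cyc_mult n \<sigma> (cyc_embed n p) (cyc_embed n q))"
  then have k: "k < n" by (simp add: cyc_mult_def)
  define E where "E f = cyc_embed n f $ k" for f :: "'b poly"
  have E: "E f = (\<Sum>j\<le>N. if j mod n = k then u (coeff f j) j else 0)"
    if "degree f \<le> N" for f N
  proof -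
    have "E f = (\<Sum>j\<le>degree f. if j mod n = k then u (coeff f j) j else 0)"
      using k by (simp add: E_def cyc_embed_def u_def cong: if_cong)
    also have "\<dots> = (\<Sum>j\<le>N. if j mod n = k then u (coeff f j) j else 0)"
      using that by (intro sum.mono_neutral_left) (auto simp: coeff_eq_0)
    finally show ?thesis .
  qed
  have E_add: "E (f + g) = E f + E g" for f g
  proof -
    define N where "N = max (degree f) (degree g)"
    have "degree f \<le> N" "degree g \<le> N" "degree (f + g) \<le> N"
      by (auto simp: N_def degree_add_le_max)
    then show ?thesis
      by (auto simp: E[where N = N] sum.distrib[symmetric] u_add intro!: sum.cong)
  qed
  have E0: "E 0 = 0" using E[of 0 0] by (simp cong: if_cong)
  have E_sum: "E (sum g A) = (\<Sum>x\<in>A. E (g x))" for g and A :: "nat set"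
    by (induction A rule: infinite_finite_induct) (simp_all add: E0 E_add)
  have E_monom: "E (monom c e) = (if e mod n = k then u c e else 0)" for c e
  proof -
    have "E (monom c e) = (\<Sum>j\<le>e. if j mod n = k then u (coeff (monom c e) j) j else 0)"
      by (rule E) (rule degree_monom_le)
    also have "\<dots> = (\<Sum>j\<le>e. if j = e then (if e mod n = k then u c e else 0) else 0)"
      by (intro sum.cong refl) auto
    finally show ?thesis by simp
  qed
  have pick: "(\<Sum>m<n. if e mod n = m then g m else 0) = g (e mod n)"
    for e and g :: "nat \<Rightarrow> 'b poly fract"
    using n by (simp add: sum.delta)
  define P where "P i = coeff p i" for i
  define Q where "Q j = coeff q j" for j
  have "cyc_mult n \<sigma> (cyc_embed n p) (cyc_embed n q) $ k =
      (\<Sum>a<n. \<Sum>b<n. if (a + b) mod n = k then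
        (\<Sum>i\<le>degree p. if i mod n = a then u (P i) i else 0) *
        S a (\<Sum>j\<le>degree q. if j mod n = b then u (Q j) j else 0) * fract_X ^ ((a + b) div n)
        else 0)"
    using k by (simp add: cyc_mult_def cyc_embed_def S_def u_def P_def Q_def cong: if_cong)
  also have "\<dots> = (\<Sum>a<n. \<Sum>b<n. \<Sum>i\<le>degree p. \<Sum>j\<le>degree q.
      if i mod n = a then if j mod n = b then if (a + b) mod n = k then
        u (P i) i * S a (u (Q j) j) * fract_X ^ ((a + b) div n) else 0 else 0 else 0)"
  proof (intro sum.cong refl)
    fix a b
    show "(if (a + b) mod n = k then
        (\<Sum>i\<le>degree p. if i mod n = a then u (P i) i else 0) *
        S a (\<Sum>j\<le>degree q. if j mod n = b then u (Q j) j else 0) * fract_X ^ ((a + b) div n)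
        else 0) = (\<Sum>i\<le>degree p. \<Sum>j\<le>degree q.
      if i mod n = a then if j mod n = b then if (a + b) mod n = k then
        u (P i) i * S a (u (Q j) j) * fract_X ^ ((a + b) div n) else 0 else 0 else 0)"
      unfolding S.hom_sum sum_product
      by (cases "(a + b) mod n = k")
         (auto simp: sum_distrib_right cong: if_cong intro!: sum.cong)
  qed
  also have "\<dots> = (\<Sum>i\<le>degree p. \<Sum>j\<le>degree q. \<Sum>b<n. \<Sum>a<n.
      if i mod n = a then if j mod n = b then if (a + b) mod n = k then
        u (P i) i * S a (u (Q j) j) * fract_X ^ ((a + b) div n) else 0 else 0 else 0)"
  proof -
    define h where "h a b i j = (if i mod n = a then if j mod n = b then if (a + b) mod n = k then
        u (P i) i * S a (u (Q j) j) * fract_X ^ ((a + b) div n) else 0 else 0 else 0)" for a b i j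
    have "(\<Sum>a<n. \<Sum>b<n. \<Sum>i\<le>degree p. \<Sum>j\<le>degree q. h a b i j) =
        (\<Sum>a<n. \<Sum>i\<le>degree p. \<Sum>b<n. \<Sum>j\<le>degree q. h a b i j)"
      by (intro sum.cong refl sum.swap)
    also have "\<dots> = (\<Sum>i\<le>degree p. \<Sum>a<n. \<Sum>b<n. \<Sum>j\<le>degree q. h a b i j)" by (rule sum.swap)
    also have "\<dots> = (\<Sum>i\<le>degree p. \<Sum>a<n. \<Sum>j\<le>degree q. \<Sum>b<n. h a b i j)"
      by (intro sum.cong refl sum.swap)
    also have "\<dots> = (\<Sum>i\<le>degree p. \<Sum>j\<le>degree q. \<Sum>a<n. \<Sum>b<n. h a b i j)"
      by (intro sum.cong refl sum.swap)
    also have "\<dots> = (\<Sum>i\<le>degree p. \<Sum>j\<le>degree q. \<Sum>b<n. \<Sum>a<n. h a b i j)"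
      by (intro sum.cong refl sum.swap)
    finally show ?thesis by (simp only: h_def)
  qed
  also have "\<dots> = (\<Sum>i\<le>degree p. \<Sum>j\<le>degree q. E (monom (P i * (\<sigma> ^^ i) (Q j)) (i + j)))"
    unfolding pick E_monom
    by (intro sum.cong refl) (simp only: Smod_u u_mult mod_simps)
  also have "\<dots> = E (skew_mult \<sigma> p q)"
    by (simp add: skew_mult_def E_sum P_def Q_def)
  finally show "cyc_embed n (skew_mult \<sigma> p q) $ k =
      cyc_mult n \<sigma> (cyc_embed n p) (cyc_embed n q) $ k"
    by (simp add: E_def)
qed (simp add: cyc_mult_def cyc_embed_def)

end

theory Submission
  imports Defs
begin

text \<open>
  Every \<open>f\<close> right-divides its reduced norm \<open>N(f)\<close>, whose degree in \<open>x\<close> is \<open>deg f = m\<close>; hence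
  \<open>deg hhat = m\<close> says that \<open>N(f)\<close> is, up to a constant, the minimal central left multiple of \<open>f\<close>.
  Multiplicativity of \<open>N\<close> shows that this minimality passes from a product to both factors, and an
  irreducible element with minimal norm has irreducible norm because it generates a maximal left
  ideal. If \<open>p\<close> is an irreducible factor of \<open>N(f)\<close>, then \<open>f\<close> and \<open>p(t\<^sup>n)\<close> are not right coprime, since
  otherwise \<open>f\<close> would divide \<open>(N(f)/p)(t\<^sup>n)\<close>; so \<open>f\<close> has an irreducible right factor of norm \<open>p\<close>, and
  splitting off such factors one by one realizes every ordering. A monic right factor with
  prescribed norm is unique, since otherwise the least common left multiple of two of them would be
  a right factor of \<open>f\<close> whose norm is not minimal. Thus a decomposition is determined by the order of
  the norms of its factors.
\<close>

section \<open>The skew polynomial ring\<close>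

locale skew_poly = field_hom \<sigma> for \<sigma> :: "'k::field \<Rightarrow> 'k"
begin

sublocale pow: field_hom "\<sigma> ^^ i" for i
  by (rule field_hom_funpow) unfold_locales

abbreviation smul :: "'k poly \<Rightarrow> 'k poly \<Rightarrow> 'k poly" (infixl "\<star>" 70)
  where "p \<star> q \<equiv> skew_mult \<sigma> p q"

text \<open>Coefficients beyond the degrees vanish, so the convolution can run over all
  \<open>i \<le> k\<close>. With ranges independent of the degrees, the distributive laws become
  coefficientwise identities.\<close>

lemma coeff_skew_mult: "coeff (p \<star> q) k = (\<Sum>i\<le>k. coeff p i * (\<sigma> ^^ i) (coeff q (k - i)))"
proof -
  have "coeff (p \<star> q) k =
      (\<Sum>i\<le>degree p. \<Sum>j\<le>degree q. if i + j = k then coeff p i * (\<sigma> ^^ i) (coeff q j) else 0)"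
    by (simp add: skew_mult_def coeff_sum)
  also have "\<dots> = (\<Sum>i\<le>degree p. if i \<le> k then coeff p i * (\<sigma> ^^ i) (coeff q (k - i)) else 0)"
  proof (intro sum.cong refl)
    fix i
    have "(\<Sum>j\<le>degree q. if i + j = k then coeff p i * (\<sigma> ^^ i) (coeff q j) else 0) =
        (\<Sum>j\<le>degree q. if j = k - i then
          (if i \<le> k then coeff p i * (\<sigma> ^^ i) (coeff q (k - i)) else 0) else 0)"
      by (intro sum.cong refl) auto
    also have "\<dots> = (if i \<le> k then coeff p i * (\<sigma> ^^ i) (coeff q (k - i)) else 0)"
      by (simp add: coeff_eq_0)
    finally show "(\<Sum>j\<le>degree q. if i + j = k then coeff p i * (\<sigma> ^^ i) (coeff q j) else 0) = \<dots>" .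
  qed
  also have "\<dots> = (\<Sum>i\<in>{..degree p} \<inter> {..k}. coeff p i * (\<sigma> ^^ i) (coeff q (k - i)))"
    by (simp add: sum.If_cases Int_def)
  also have "\<dots> = (\<Sum>i\<le>k. coeff p i * (\<sigma> ^^ i) (coeff q (k - i)))"
    by (rule sum.mono_neutral_left) (auto simp: coeff_eq_0)
  finally show ?thesis .
qed

lemma skew_mult_add_left: "(p + q) \<star> r = p \<star> r + q \<star> r"
  by (rule poly_eqI) (simp add: coeff_skew_mult algebra_simps sum.distrib)

lemma skew_mult_add_right: "p \<star> (q + r) = p \<star> q + p \<star> r"
  by (rule poly_eqI) (simp add: coeff_skew_mult algebra_simps sum.distrib pow.hom_add)

lemma skew_mult_minus_left: "(- p) \<star> q = - (p \<star> q)"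
  by (rule poly_eqI) (simp add: coeff_skew_mult sum_negf)

lemma skew_mult_diff_left: "(p - q) \<star> r = p \<star> r - q \<star> r"
  using skew_mult_add_left[of p "- q" r] by (simp add: skew_mult_minus_left)

lemma skew_mult_0_left [simp]: "0 \<star> p = 0"
  by (rule poly_eqI) (simp add: coeff_skew_mult)

lemma skew_mult_0_right [simp]: "p \<star> 0 = 0"
  by (rule poly_eqI) (simp add: coeff_skew_mult)

lemma skew_mult_sum_left: "sum g S \<star> p = (\<Sum>i\<in>S. g i \<star> p)"
  by (induction S rule: infinite_finite_induct) (simp_all add: skew_mult_add_left)

lemma skew_mult_sum_right: "p \<star> sum g S = (\<Sum>i\<in>S. p \<star> g i)"
  by (induction S rule: infinite_finite_induct) (simp_all add: skew_mult_add_right)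

lemma skew_mult_monom: "monom a i \<star> monom b j = monom (a * (\<sigma> ^^ i) b) (i + j)"
proof (rule poly_eqI)
  fix k
  have "coeff (monom a i \<star> monom b j) k =
      (\<Sum>l\<le>k. if l = i then (if i + j = k then a * (\<sigma> ^^ i) b else 0) else 0)"
    unfolding coeff_skew_mult by (intro sum.cong refl) (auto simp: le_imp_diff_is_add)
  then show "coeff (monom a i \<star> monom b j) k = coeff (monom (a * (\<sigma> ^^ i) b) (i + j)) k"
    by auto
qed

text \<open>Distributivity reduces the law to monomials, expanding the second or third argument
  before the first. For monomials it says that \<sigma>^i is multiplicative and that powers of
  \<sigma> compose additively.\<close>

lemma skew_mult_assoc: "(p \<star> q) \<star> r = p \<star> (q \<star> r)"
proof -
  define S where "S p = (\<Sum>i\<le>degree p. monom (coeff p i) i)" for p :: "'k poly"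
  have S: "S p = p" for p by (simp add: S_def poly_as_sum_of_monoms)
  have mmm: "(monom a i \<star> monom b j) \<star> monom c k = monom a i \<star> (monom b j \<star> monom c k)"
    for a b c i j k
  proof -
    have "(\<sigma> ^^ i) (b * (\<sigma> ^^ j) c) = (\<sigma> ^^ i) b * (\<sigma> ^^ (i + j)) c"
      by (simp only: funpow_add comp_apply pow.hom_mult)
    then show ?thesis unfolding skew_mult_monom by (simp only: mult.assoc add.assoc)
  qed
  have "(monom a i \<star> monom b j) \<star> S r = monom a i \<star> (monom b j \<star> S r)" for a b i j
    by (simp only: S_def skew_mult_sum_right mmm)
  then have mm: "(monom a i \<star> monom b j) \<star> r = monom a i \<star> (monom b j \<star> r)" for a b i j
    by (simp only: S)
  have "(monom a i \<star> S q) \<star> r = monom a i \<star> (S q \<star> r)" for a i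
    by (simp only: S_def skew_mult_sum_right skew_mult_sum_left mm)
  then have m: "(monom a i \<star> q) \<star> r = monom a i \<star> (q \<star> r)" for a i
    by (simp only: S)
  have "(S p \<star> q) \<star> r = S p \<star> (q \<star> r)"
    by (simp only: S_def skew_mult_sum_left m)
  then show ?thesis by (simp only: S)
qed

lemma skew_mult_const_left: "[:c:] \<star> p = Polynomial.smult c p"
proof (rule poly_eqI)
  fix k
  have "coeff ([:c:] \<star> p) k = (\<Sum>i\<le>k. if i = 0 then c * coeff p k else 0)"
    unfolding coeff_skew_mult by (intro sum.cong refl) (auto simp: coeff_pCons split: nat.splits)
  then show "coeff ([:c:] \<star> p) k = coeff (Polynomial.smult c p) k" by simp
qed

lemma skew_mult_1_left [simp]: "1 \<star> p = p"
  using skew_mult_const_left[of 1 p] by (simp add: one_pCons)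

lemma skew_mult_1_right [simp]: "p \<star> 1 = p"
proof (rule poly_eqI)
  fix k
  have "coeff (p \<star> 1) k = (\<Sum>i\<le>k. if i = k then coeff p k else 0)"
    unfolding coeff_skew_mult by (intro sum.cong refl) auto
  then show "coeff (p \<star> 1) k = coeff p k" by simp
qed

lemma skew_mult_monom_1: "p \<star> monom 1 k = p * monom 1 k"
  by (subst (1 2) poly_as_sum_of_monoms[of p, symmetric])
     (simp add: skew_mult_sum_left sum_distrib_right skew_mult_monom mult_monom)

lemma coeff_skew_mult_top:
  "coeff (p \<star> q) (degree p + degree q) = lead_coeff p * (\<sigma> ^^ degree p) (lead_coeff q)"
proof -
  have "coeff (p \<star> q) (degree p + degree q) = (\<Sum>i\<le>degree p + degree q.
      if i = degree p then lead_coeff p * (\<sigma> ^^ degree p) (lead_coeff q) else 0)"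
    unfolding coeff_skew_mult
  proof (intro sum.cong refl)
    fix i
    show "coeff p i * (\<sigma> ^^ i) (coeff q (degree p + degree q - i)) =
      (if i = degree p then lead_coeff p * (\<sigma> ^^ degree p) (lead_coeff q) else 0)"
      by (cases i "degree p" rule: linorder_cases) (auto simp: coeff_eq_0)
  qed
  then show ?thesis by simp
qed

lemma degree_skew_mult_le: "degree (p \<star> q) \<le> degree p + degree q"
proof (rule degree_le, intro allI impI)
  fix k assume k: "degree p + degree q < k"
  have "coeff p i * (\<sigma> ^^ i) (coeff q (k - i)) = 0" for i
    using k by (cases "i \<le> degree p") (auto simp: coeff_eq_0)
  then show "coeff (p \<star> q) k = 0" unfolding coeff_skew_mult by (intro sum.neutral ballI)
qed

text \<open>The top coefficient is a product of a leading coefficient and the image of the other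
  under a power of \<sigma>. It is nonzero because field homomorphisms are injective.\<close>

lemma degree_skew_mult:
  assumes "p \<noteq> 0" "q \<noteq> 0"
  shows "degree (p \<star> q) = degree p + degree q"
  using assms degree_skew_mult_le[of p q] coeff_skew_mult_top[of p q]
  by (intro antisym le_degree) auto

lemma lead_coeff_skew_mult:
  "lead_coeff (p \<star> q) = lead_coeff p * (\<sigma> ^^ degree p) (lead_coeff q)"
  by (cases "p = 0 \<or> q = 0") (auto simp: degree_skew_mult coeff_skew_mult_top[symmetric])

lemma skew_mult_eq_0_iff [simp]: "p \<star> q = 0 \<longleftrightarrow> p = 0 \<or> q = 0"
  using lead_coeff_skew_mult[of p q] by auto

lemma skew_mult_cancel_right: "r \<noteq> 0 \<Longrightarrow> p \<star> r = q \<star> r \<longleftrightarrow> p = q"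
  using skew_mult_eq_0_iff[of "p - q" r] by (auto simp: skew_mult_diff_left)

lemma monic_left_factor:
  assumes "lead_coeff (p \<star> q) = 1" "lead_coeff q = 1"
  shows "lead_coeff p = 1"
  using assms by (simp add: lead_coeff_skew_mult)

section \<open>Right division and principal left ideals\<close>

lemma skew_div_mod:
  assumes "g \<noteq> 0"
  shows "\<exists>q r. p = q \<star> g + r \<and> (r = 0 \<or> degree r < degree g)"
proof (induction "degree p" arbitrary: p rule: less_induct)
  case less
  show ?case
  proof (cases "p = 0 \<or> degree p < degree g")
    case True
    then show ?thesis by (intro exI[of _ 0] exI[of _ p]) auto
  next
    case False
    define e where "e = degree p - degree g"
    \<comment> \<open>Moving \<open>t^e\<close> past the leading coefficient of \<open>g\<close>
      applies \<sigma>^e to it, so this twisted value has to be divided out for \<open>s\<close> to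
      have the leading term of \<open>p\<close>.\<close>
    define c where "c = lead_coeff p / (\<sigma> ^^ e) (lead_coeff g)"
    define s where "s = monom c e \<star> g"
    have nz: "(\<sigma> ^^ e) (lead_coeff g) \<noteq> 0" using assms by simp
    have c: "c \<noteq> 0" using False nz by (simp add: c_def)
    have deg: "degree s = degree p"
      using False c assms by (simp add: s_def degree_skew_mult degree_monom_eq e_def)
    have lc: "lead_coeff s = lead_coeff p"
      using nz c unfolding s_def lead_coeff_skew_mult by (simp add: degree_monom_eq c_def)
    show ?thesis
    proof (cases "p - s = 0")
      case True
      then have "p = monom c e \<star> g + 0" by (simp add: s_def)
      then show ?thesis by blast
    next
      case nz: False
      have "coeff (p - s) (degree p) = 0" using deg lc by simp
      moreover have "degree (p - s) \<le> degree p" using deg by (metis degree_diff_le order_refl)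
      ultimately have "degree (p - s) < degree p"
        using nz by (metis leading_coeff_0_iff order_le_imp_less_or_eq)
      from less[OF this] obtain q r where
        qr: "p - s = q \<star> g + r" "r = 0 \<or> degree r < degree g" by blast
      then have "p = (q + monom c e) \<star> g + r"
        by (simp add: skew_mult_add_left s_def algebra_simps)
      then show ?thesis using qr(2) by blast
    qed
  qed
qed

text \<open>A nonzero element of least degree generates: the remainder of any member on right
  division by it lies in \<open>J\<close> again and must be 0.\<close>

lemma left_ideal_principal:
  assumes "\<And>p q. p \<in> J \<Longrightarrow> q \<in> J \<Longrightarrow> p - q \<in> J" "\<And>p q. q \<in> J \<Longrightarrow> p \<star> q \<in> J"
    and "r \<in> J" "r \<noteq> 0"
  obtains g where "g \<in> J" "g \<noteq> 0" "\<And>p. p \<in> J \<Longrightarrow> right_divides \<sigma> g p"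
proof -
  obtain g where g: "g \<in> J" "g \<noteq> 0" and min: "\<And>h. h \<in> J \<Longrightarrow> h \<noteq> 0 \<Longrightarrow> degree g \<le> degree h"
    using ex_has_least_nat[of "\<lambda>g. g \<in> J \<and> g \<noteq> 0" r degree] assms(3,4) by auto
  have "right_divides \<sigma> g p" if "p \<in> J" for p
  proof -
    obtain q r where qr: "p = q \<star> g + r" "r = 0 \<or> degree r < degree g"
      using skew_div_mod[OF g(2)] by blast
    have "r = p - q \<star> g" using qr by simp
    then have "r \<in> J" using assms(1,2) that g(1) by blast
    then have "r = 0" using qr min by fastforce
    then show ?thesis using qr by (auto simp: right_divides_def)
  qed
  then show ?thesis using that g by blast
qed

lemma right_divides_trans: "right_divides \<sigma> a b \<Longrightarrow> right_divides \<sigma> b c \<Longrightarrow> right_divides \<sigma> a c"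
  unfolding right_divides_def by (metis skew_mult_assoc)

lemma right_divides_diff:
  "right_divides \<sigma> a b \<Longrightarrow> right_divides \<sigma> a c \<Longrightarrow> right_divides \<sigma> a (b - c)"
  unfolding right_divides_def by (metis skew_mult_diff_left)

lemma right_divides_mult: "right_divides \<sigma> a b \<Longrightarrow> right_divides \<sigma> a (c \<star> b)"
  unfolding right_divides_def by (metis skew_mult_assoc)

lemma right_divides_same_degree:
  assumes "right_divides \<sigma> a b" "b \<noteq> 0" "degree a = degree b"
  obtains c where "c \<noteq> 0" "b = Polynomial.smult c a"
proof -
  obtain u where u: "b = u \<star> a" using assms by (auto simp: right_divides_def)
  then have "u \<noteq> 0" "a \<noteq> 0" using assms by auto
  then have "degree u = 0" using assms u by (simp add: degree_skew_mult)
  then obtain c where c: "u = [:c:]" by (metis degree_eq_zeroE)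
  show ?thesis using that[of c] u \<open>u \<noteq> 0\<close> c by (simp add: skew_mult_const_left)
qed

section \<open>Units, irreducible elements and products\<close>

lemma skew_unit_iff: "skew_unit \<sigma> p \<longleftrightarrow> p \<noteq> 0 \<and> degree p = 0"
proof
  assume "skew_unit \<sigma> p"
  then obtain q where q: "p \<star> q = 1" by (auto simp: skew_unit_def)
  then have "p \<noteq> 0" "q \<noteq> 0" by auto
  then show "p \<noteq> 0 \<and> degree p = 0" using arg_cong[OF q, of degree] by (simp add: degree_skew_mult)
next
  assume p: "p \<noteq> 0 \<and> degree p = 0"
  then obtain c where "p = [:c:]" "c \<noteq> 0" by (metis degree_eq_zeroE pCons_eq_0_iff)
  then show "skew_unit \<sigma> p" unfolding skew_unit_def
    by (intro exI[of _ "[:1 / c:]"]) (simp add: skew_mult_const_left one_pCons)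
qed

text \<open>Degrees add, so two factors of positive degree both have degree below
  \<open>degree p\<close>. The criterion can therefore be applied to any factorization by looking
  for a factor of degree 0.\<close>

lemma skew_irreducible_iff:
  "skew_irreducible \<sigma> p \<longleftrightarrow> 1 \<le> degree p \<and> (\<forall>g q. p = g \<star> q \<longrightarrow> degree g = 0 \<or> degree q = 0)"
proof
  assume p: "skew_irreducible \<sigma> p"
  then have "1 \<le> degree p" "p \<noteq> 0" by (auto simp: skew_irreducible_def skew_unit_iff)
  moreover have "degree g = 0 \<or> degree q = 0" if "p = g \<star> q" for g q
  proof (rule ccontr)
    assume nz: "\<not> ?thesis"
    moreover from nz have "g \<noteq> 0" "q \<noteq> 0" by auto
    moreover from this nz have "degree g < degree p" "degree q < degree p"
      using that by (auto simp: degree_skew_mult)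
    ultimately show False using p that unfolding skew_irreducible_def by force
  qed
  ultimately show "1 \<le> degree p \<and> (\<forall>g q. p = g \<star> q \<longrightarrow> degree g = 0 \<or> degree q = 0)" by blast
next
  assume p: "1 \<le> degree p \<and> (\<forall>g q. p = g \<star> q \<longrightarrow> degree g = 0 \<or> degree q = 0)"
  then show "skew_irreducible \<sigma> p" unfolding skew_irreducible_def skew_unit_iff
    by (metis degree_0 not_one_le_zero)
qed

text \<open>Serves to move constants between neighbouring factors; they are allowed on both sides
  because they do not commute with \<open>t\<close>. Multiplying a factorization of the product by
  the inverse constants on the outside gives one of \<open>p\<close> with the same degrees.\<close>

lemma skew_irreducible_const_mult:
  assumes "skew_irreducible \<sigma> p" "a \<noteq> 0" "b \<noteq> 0"
  shows "skew_irreducible \<sigma> ([:a:] \<star> p \<star> [:b:])"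
proof -
  have p: "p \<noteq> 0" using assms by (simp add: skew_irreducible_def)
  have inv: "[:1 / c:] \<star> [:c:] = 1" "[:c:] \<star> [:1 / c:] = 1" if "c \<noteq> 0" for c
    using that by (simp_all add: skew_mult_const_left one_pCons)
  have irr: "degree g = 0 \<or> degree q = 0" if "p = g \<star> q" for g q
    using assms(1) that by (simp add: skew_irreducible_iff)
  have "degree g = 0 \<or> degree q = 0" if eq: "[:a:] \<star> p \<star> [:b:] = g \<star> q" for g q
  proof -
    have "p = ([:1 / a:] \<star> [:a:]) \<star> p \<star> ([:b:] \<star> [:1 / b:])" using assms by (simp add: inv)
    also have "\<dots> = [:1 / a:] \<star> ([:a:] \<star> p \<star> [:b:]) \<star> [:1 / b:]" by (simp only: skew_mult_assoc)
    also have "\<dots> = [:1 / a:] \<star> (g \<star> q) \<star> [:1 / b:]" by (simp only: eq)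
    also have "\<dots> = ([:1 / a:] \<star> g) \<star> (q \<star> [:1 / b:])" by (simp only: skew_mult_assoc)
    finally have "p = ([:1 / a:] \<star> g) \<star> (q \<star> [:1 / b:])" .
    with irr have "degree ([:1 / a:] \<star> g) = 0 \<or> degree (q \<star> [:1 / b:]) = 0" .
    moreover have "g \<noteq> 0" "q \<noteq> 0" using eq p assms by auto
    ultimately show ?thesis using assms by (simp add: degree_skew_mult)
  qed
  moreover have "degree ([:a:] \<star> p \<star> [:b:]) = degree p" using p assms by (simp add: degree_skew_mult)
  ultimately show ?thesis using assms by (simp add: skew_irreducible_iff)
qed

text \<open>A right divisor of least positive degree is irreducible, since a right factor of it
  divides \<open>p\<close> as well. Normalizing by a constant on the left keeps it a right
  divisor.\<close>

lemma ex_irreducible_right_factor: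
  assumes "1 \<le> degree p"
  obtains g where "skew_irreducible \<sigma> g" "lead_coeff g = 1" "right_divides \<sigma> g p"
proof -
  have pp: "right_divides \<sigma> p p" by (auto simp: right_divides_def intro: exI[of _ 1])
  obtain g where g: "right_divides \<sigma> g p" "1 \<le> degree g"
    and min: "\<And>h. right_divides \<sigma> h p \<Longrightarrow> 1 \<le> degree h \<Longrightarrow> degree g \<le> degree h"
    using ex_has_least_nat[of "\<lambda>g. right_divides \<sigma> g p \<and> 1 \<le> degree g" p degree] assms pp by auto
  have "degree a = 0 \<or> degree b = 0" if ab: "g = a \<star> b" for a b
  proof (rule ccontr)
    assume nz: "\<not> ?thesis"
    moreover from nz have "a \<noteq> 0" "b \<noteq> 0" by auto
    ultimately have "degree b < degree g" using ab by (auto simp: degree_skew_mult)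
    moreover have "right_divides \<sigma> b p" using g(1) ab right_divides_mult[of b b a] right_divides_trans
      by (metis right_divides_def)
    ultimately show False using min[of b] nz by simp
  qed
  then have irr: "skew_irreducible \<sigma> g" using g by (simp add: skew_irreducible_iff)
  define c where "c = lead_coeff g"
  have "g \<noteq> 0" using g by auto
  then have c: "c \<noteq> 0" by (simp add: c_def)
  define h where "h = [:1 / c:] \<star> g"
  have "g = [:c:] \<star> h" using c by (simp add: h_def skew_mult_const_left)
  then have "right_divides \<sigma> h p" using g(1) right_divides_trans by (metis right_divides_def)
  moreover have "lead_coeff h = 1" using c by (simp add: h_def skew_mult_const_left flip: c_def)
  moreover have "skew_irreducible \<sigma> h"
    using skew_irreducible_const_mult[OF irr, of "1 / c" 1] c by (simp add: h_def one_pCons[symmetric])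
  ultimately show ?thesis using that by blast
qed

lemma skew_prod_Nil [simp]: "skew_prod \<sigma> [] = 1"
  and skew_prod_Cons [simp]: "skew_prod \<sigma> (g # gs) = g \<star> skew_prod \<sigma> gs"
  by (simp_all add: skew_prod_def)

lemma skew_prod_append: "skew_prod \<sigma> (fs @ gs) = skew_prod \<sigma> fs \<star> skew_prod \<sigma> gs"
  by (induction fs) (simp_all add: skew_mult_assoc)

end

section \<open>The reduced norm as a determinant over $K[x]$\<close>

lemma degree_prod_le_sum:
  "finite S \<Longrightarrow> (\<And>i. i \<in> S \<Longrightarrow> degree (p i) \<le> w i) \<Longrightarrow> degree (\<Prod>i\<in>S. p i) \<le> (\<Sum>i\<in>S. w i)"
  for p :: "'a \<Rightarrow> 'b::comm_semiring_1 poly"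
proof (induction S rule: finite_induct)
  case (insert x S)
  then show ?case using degree_mult_le[of "p x" "\<Prod>i\<in>S. p i"] by (fastforce intro: order_trans)
qed simp

lemma coeff_mult_top:
  fixes p q :: "'b::comm_semiring_1 poly"
  assumes "degree p \<le> a" "degree q \<le> b"
  shows "coeff (p * q) (a + b) = coeff p a * coeff q b"
proof -
  have "coeff (p * q) (a + b) = (\<Sum>i\<le>a + b. if i = a then coeff p a * coeff q b else 0)"
    unfolding coeff_mult
  proof (intro sum.cong refl)
    fix i
    show "coeff p i * coeff q (a + b - i) = (if i = a then coeff p a * coeff q b else 0)"
      using assms by (cases i a rule: linorder_cases) (auto simp: coeff_eq_0)
  qed
  then show ?thesis by simp
qed

lemma coeff_prod_top:
  fixes p :: "'a \<Rightarrow> 'b::comm_semiring_1 poly"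
  assumes "finite S" "\<And>i. i \<in> S \<Longrightarrow> degree (p i) \<le> w i"
  shows "coeff (\<Prod>i\<in>S. p i) (\<Sum>i\<in>S. w i) = (\<Prod>i\<in>S. coeff (p i) (w i))"
  using assms
proof (induction S rule: finite_induct)
  case (insert x S)
  then show ?case by (simp add: coeff_mult_top degree_prod_le_sum)
qed simp

text \<open>Each Leibniz term takes one entry from every row, so its degree is at most the sum of
  the row bounds. Its coefficient there is the product of the coefficients at the bounds, even if
  these are not attained.\<close>

lemma det_row_degrees:
  fixes A :: "'b::comm_ring_1 poly mat"
  assumes A: "A \<in> carrier_mat n n" and w: "\<And>i j. i < n \<Longrightarrow> j < n \<Longrightarrow> degree (A $$ (i, j)) \<le> w i"
  shows "degree (det A) \<le> (\<Sum>i<n. w i)"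
    and "coeff (det A) (\<Sum>i<n. w i) = det (mat n n (\<lambda>(i, j). coeff (A $$ (i, j)) (w i)))"
proof -
  have pd: "degree (\<Prod>i = 0..<n. A $$ (i, p i)) \<le> (\<Sum>i<n. w i)" if "p permutes {0..<n}" for p
    unfolding lessThan_atLeast0
    by (intro degree_prod_le_sum w) (use permutes_in_image[OF that] in auto)
  have pc: "coeff (\<Prod>i = 0..<n. A $$ (i, p i)) (\<Sum>i<n. w i) = (\<Prod>i = 0..<n. coeff (A $$ (i, p i)) (w i))"
    if "p permutes {0..<n}" for p
    unfolding lessThan_atLeast0
    by (intro coeff_prod_top w) (use permutes_in_image[OF that] in auto)
  have sg: "signof p * q = (if evenperm p then q else - q)" for p :: "nat \<Rightarrow> nat" and q :: "'b poly"
    by (simp add: sign_def)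
  have sg': "signof p * q = (if evenperm p then q else - q)" for p :: "nat \<Rightarrow> nat" and q :: 'b
    by (simp add: sign_def)
  show "degree (det A) \<le> (\<Sum>i<n. w i)"
    unfolding det_def'[OF A] sg by (intro degree_sum_le finite_permutations) (auto intro: pd)
  show "coeff (det A) (\<Sum>i<n. w i) = det (mat n n (\<lambda>(i, j). coeff (A $$ (i, j)) (w i)))"
  proof -
    have "coeff (det A) (\<Sum>i<n. w i) = (\<Sum>p\<in>{p. p permutes {0..<n}}.
        coeff (signof p * (\<Prod>i = 0..<n. A $$ (i, p i))) (\<Sum>i<n. w i))"
      unfolding det_def'[OF A] by (simp add: coeff_sum)
    also have "\<dots> = (\<Sum>p\<in>{p. p permutes {0..<n}}.
        signof p * (\<Prod>i = 0..<n. mat n n (\<lambda>(i, j). coeff (A $$ (i, j)) (w i)) $$ (i, p i)))"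
    proof (intro sum.cong refl)
      fix p assume "p \<in> {p. p permutes {0..<n}}"
      then have p: "p permutes {0..<n}" by simp
      have "(\<Prod>i = 0..<n. mat n n (\<lambda>(i, j). coeff (A $$ (i, j)) (w i)) $$ (i, p i)) =
          (\<Prod>i = 0..<n. coeff (A $$ (i, p i)) (w i))"
        using permutes_in_image[OF p] by (intro prod.cong refl) auto
      then show "coeff (signof p * (\<Prod>i = 0..<n. A $$ (i, p i))) (\<Sum>i<n. w i) =
          signof p * (\<Prod>i = 0..<n. mat n n (\<lambda>(i, j). coeff (A $$ (i, j)) (w i)) $$ (i, p i))"
        using pc[OF p] unfolding sg sg' by simp
    qed
    also have "\<dots> = det (mat n n (\<lambda>(i, j). coeff (A $$ (i, j)) (w i)))"
      by (subst det_def'[of _ n]) auto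
    finally show ?thesis .
  qed
qed

locale cyclic_algebra =
  fixes \<iota> :: "'f::field \<Rightarrow> 'k::field" and \<sigma> :: "'k \<Rightarrow> 'k" and n :: nat
  assumes cyclic: "cyclic_galois_extension \<iota> \<sigma> n"
begin

sublocale skew_poly \<sigma>
  using cyclic_galois_field_hom(1)[OF cyclic] by (simp add: skew_poly_def)

sublocale base: field_hom \<iota>
  using cyclic by (simp add: cyclic_galois_extension_def)

sublocale base_poly: map_poly_inj_idom_hom \<iota> ..

section \<open>Powers of \<sigma> and the substitution of t^n for x\<close>

lemma n_pos: "0 < n"
  using cyclic by (simp add: cyclic_galois_extension_def)

lemma pow_n: "(\<sigma> ^^ n) a = a"
  by (simp add: cyclic_galois_funpow_n[OF cyclic])

lemma pow_mult_n: "(\<sigma> ^^ (n * i)) a = a"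
proof (induction i)
  case (Suc i)
  then show ?case by (simp add: funpow_add pow_n)
qed simp

lemma pow_base: "(\<sigma> ^^ i) (\<iota> a) = \<iota> a"
  by (induction i) (simp_all add: cyclic_galois_field_hom(3)[OF cyclic])

text \<open>The Galois group consists of the powers of \<sigma>, so an element fixed by \<sigma>
  lies in the fixed field of the whole group, which is F.\<close>

lemma fixed_in_base:
  assumes "\<sigma> a = a"
  shows "a \<in> range \<iota>"
proof -
  have "(\<sigma> ^^ i) a = a" for i by (induction i) (simp_all add: assms)
  then have "\<forall>\<tau>\<in>galois_group \<iota>. \<tau> a = a"
    using cyclic by (auto simp: cyclic_galois_extension_def)
  then show ?thesis using cyclic unfolding cyclic_galois_extension_def by blast
qed

text \<open>The analogue of \<open>eval_at_tn\<close> for polynomials over K, which are the entries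
  of the norm matrix. Its values need not be central.\<close>

definition at_tn :: "'k poly \<Rightarrow> 'k poly" where
  "at_tn c = pcompose c (monom 1 n)"

lemma eval_at_tn_eq: "eval_at_tn \<iota> n h = at_tn (map_poly \<iota> h)"
  by (simp add: eval_at_tn_def at_tn_def)

lemma coeff_at_tn: "coeff (at_tn c) j = (if n dvd j then coeff c (j div n) else 0)"
proof -
  have "coeff (at_tn c) (n * (j div n) + j mod n) = (if j mod n = 0 then coeff c (j div n) else 0)"
    unfolding at_tn_def using n_pos by (intro coeff_pcompose_monom) simp
  then show ?thesis by (simp add: dvd_eq_mod_eq_0)
qed

lemma at_tn_mult: "at_tn (a * b) = at_tn a * at_tn b"
  by (simp add: at_tn_def pcompose_mult)

lemma at_tn_add: "at_tn (a + b) = at_tn a + at_tn b"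
  by (simp add: at_tn_def pcompose_add)

lemma at_tn_0 [simp]: "at_tn 0 = 0"
  by (simp add: at_tn_def)

lemma at_tn_sum: "at_tn (sum g S) = (\<Sum>i\<in>S. at_tn (g i))"
  by (induction S rule: infinite_finite_induct) (simp_all add: at_tn_add)

lemma degree_at_tn: "degree (at_tn c) = n * degree c"
  by (simp add: at_tn_def degree_pcompose degree_monom_eq)

text \<open>Only exponents divisible by \<open>n\<close> occur on the left, and the corresponding
  powers of \<sigma> are the identity, so nothing is twisted.\<close>

lemma at_tn_skew_mult: "at_tn c \<star> p = at_tn c * p"
proof (rule poly_eqI)
  fix k
  have "coeff (at_tn c) i * (\<sigma> ^^ i) a = coeff (at_tn c) i * a" for i a
    by (auto simp: coeff_at_tn pow_mult_n elim!: dvdE)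
  then show "coeff (at_tn c \<star> p) k = coeff (at_tn c * p) k"
    by (simp only: coeff_skew_mult coeff_mult)
qed

lemma at_tn_mult_assoc: "(at_tn c * p) \<star> q = at_tn c * (p \<star> q)"
  by (metis at_tn_skew_mult skew_mult_assoc)

text \<open>Here the twist falls on coefficients from F, which \<sigma> fixes. Together with
  \<open>at_tn_skew_mult\<close> for the other side this makes h(t^n) central for h over F.\<close>

lemma skew_mult_eval_at_tn: "p \<star> eval_at_tn \<iota> n h = p * eval_at_tn \<iota> n h"
proof (rule poly_eqI)
  fix k
  have "(\<sigma> ^^ i) (coeff (eval_at_tn \<iota> n h) j) = coeff (eval_at_tn \<iota> n h) j" for i j
    by (simp add: eval_at_tn_eq coeff_at_tn coeff_map_poly pow_base)
  then show "coeff (p \<star> eval_at_tn \<iota> n h) k = coeff (p * eval_at_tn \<iota> n h) k"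
    by (simp only: coeff_skew_mult coeff_mult)
qed

lemma eval_at_tn_skew_mult: "eval_at_tn \<iota> n h \<star> p = eval_at_tn \<iota> n h * p"
  by (simp add: eval_at_tn_eq at_tn_skew_mult)

lemma eval_at_tn_commute: "eval_at_tn \<iota> n h \<star> p = p \<star> eval_at_tn \<iota> n h"
  by (simp add: skew_mult_eval_at_tn eval_at_tn_skew_mult)

lemma eval_at_tn_mult: "eval_at_tn \<iota> n (a * b) = eval_at_tn \<iota> n a \<star> eval_at_tn \<iota> n b"
  by (simp add: eval_at_tn_skew_mult) (simp add: eval_at_tn_eq at_tn_mult base_poly.hom_mult)

lemma eval_at_tn_diff: "eval_at_tn \<iota> n (a - b) = eval_at_tn \<iota> n a - eval_at_tn \<iota> n b"
  by (simp add: eval_at_tn_eq at_tn_def base_poly.hom_minus pcompose_diff)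

lemma degree_eval_at_tn: "degree (eval_at_tn \<iota> n h) = n * degree h"
  by (simp add: eval_at_tn_eq degree_at_tn)

lemma eval_at_tn_eq_0_iff: "eval_at_tn \<iota> n h = 0 \<longleftrightarrow> h = 0"
proof
  assume h: "eval_at_tn \<iota> n h = 0"
  have "\<iota> (coeff h i) = coeff (eval_at_tn \<iota> n h) (n * i)" for i
    using n_pos by (simp add: eval_at_tn_eq coeff_at_tn coeff_map_poly)
  then show "h = 0" using h by (simp add: poly_eq_iff)
qed (simp add: eval_at_tn_def)

section \<open>Coordinates over K[x] for the basis 1, t, ..., t^(n-1), and the norm matrix\<close>

definition tpart :: "nat \<Rightarrow> 'k poly \<Rightarrow> 'k poly" where
  "tpart k p = (\<Sum>j\<le>degree p. if j mod n = k then monom (coeff p j) (j div n) else 0)"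

lemma coeff_tpart:
  assumes "k < n"
  shows "coeff (tpart k p) e = coeff p (n * e + k)"
proof -
  have "coeff (tpart k p) e = (\<Sum>j\<le>degree p. if j = n * e + k then coeff p (n * e + k) else 0)"
    unfolding tpart_def coeff_sum
  proof (intro sum.cong refl)
    fix j
    have "j = n * e + k \<longleftrightarrow> j mod n = k \<and> j div n = e"
      using assms by (metis add.commute div_mult_self4 div_less mod_less mod_mult_self4
        mult_div_mod_eq add_0 n_pos neq0_conv mod_mult_self2 plus_nat.add_0 div_mult_self2)
    then show "coeff (if j mod n = k then monom (coeff p j) (j div n) else 0) e =
        (if j = n * e + k then coeff p (n * e + k) else 0)" by auto
  qed
  then show ?thesis by (simp add: coeff_eq_0)
qed

lemma tpart_decomposition: "(\<Sum>k<n. at_tn (tpart k p) * monom 1 k) = p"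
proof (rule poly_eqI)
  fix j
  have "coeff (\<Sum>k<n. at_tn (tpart k p) * monom 1 k) j =
      (\<Sum>k<n. if k = j mod n then coeff p j else 0)"
    unfolding coeff_sum
  proof (intro sum.cong refl)
    fix k assume "k \<in> {..<n}"
    then have k: "k < n" by simp
    have "k \<le> j \<and> n dvd j - k \<longleftrightarrow> k = j mod n"
    proof
      assume "k \<le> j \<and> n dvd j - k"
      then show "k = j mod n" using k by (metis mod_less mod_nat_eqI)
    qed (auto simp: minus_mod_eq_mult_div)
    moreover have "n * ((j - k) div n) + k = j" if "k = j mod n"
      using that by (simp add: minus_mod_eq_mult_div)
    ultimately show "coeff (at_tn (tpart k p) * monom 1 k) j = (if k = j mod n then coeff p j else 0)"
      using k by (auto simp: mult.commute[of _ "monom 1 k"] coeff_monom_mult coeff_at_tn coeff_tpart)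
  qed
  then show "coeff (\<Sum>k<n. at_tn (tpart k p) * monom 1 k) j = coeff p j"
    using n_pos by simp
qed

text \<open>Right multiplication by \<open>f\<close> on the free left $K[x]$-module $R$ with basis $1, t, \dots, t^{n-1}$.\<close>

definition norm_mat :: "'k poly \<Rightarrow> 'k poly mat" where
  "norm_mat f = mat n n (\<lambda>(i, k). tpart k (monom 1 i \<star> f))"

text \<open>The reduced norm as an element of K[x], before its coefficients are shown to lie in
  F.\<close>

definition poly_norm :: "'k poly \<Rightarrow> 'k poly" where
  "poly_norm f = det (norm_mat f)"

lemma norm_mat_carrier [simp]: "norm_mat f \<in> carrier_mat n n"
  by (simp add: norm_mat_def)

lemma dim_norm_mat [simp]: "dim_row (norm_mat f) = n" "dim_col (norm_mat f) = n"
  by (simp_all add: norm_mat_def)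

interpretation to_fract: comm_ring_hom "to_fract :: 'k poly \<Rightarrow> 'k poly fract"
  by unfold_locales auto

lemma cyc_embed_eq: "cyc_embed n f = vec n (\<lambda>k. to_fract (tpart k f))"
proof (rule eq_vecI)
  fix k assume "k < dim_vec (vec n (\<lambda>k. to_fract (tpart k f)))"
  then show "cyc_embed n f $ k = vec n (\<lambda>k. to_fract (tpart k f)) $ k"
    by (auto simp: cyc_embed_def tpart_def to_fract.hom_sum intro!: sum.cong)
qed (simp add: cyc_embed_def)

lemma unit_vec_eq_cyc_embed:
  assumes "i < n"
  shows "unit_vec n i = cyc_embed n (monom (1 :: 'k) i)"
proof -
  have "tpart k (monom 1 i) = (if k = i then 1 else 0)" if "k < n" for k
  proof (rule poly_eqI)
    fix e
    have "n * e + k = i \<longleftrightarrow> e = 0 \<and> k = i" using assms that by (cases e) auto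
    then show "coeff (tpart k (monom 1 i)) e = coeff (if k = i then 1 else 0) e"
      using that by (auto simp: coeff_tpart coeff_1)
  qed
  then show ?thesis using assms by (intro eq_vecI) (auto simp: cyc_embed_eq)
qed

text \<open>The unit vector \<open>i\<close> is the image of t^i, so row \<open>i\<close> of the
  splitting matrix holds the coordinates of t^i f. For f in R these are polynomials, and the
  determinant can be studied over K[x].\<close>

lemma cyc_rep_embed: "cyc_rep n \<sigma> (cyc_embed n f) = map_mat to_fract (norm_mat f)"
proof (rule eq_matI)
  fix i k assume "i < dim_row (map_mat to_fract (norm_mat f))" "k < dim_col (map_mat to_fract (norm_mat f))"
  then have ik: "i < n" "k < n" by (simp_all add: norm_mat_def)
  then have "cyc_rep n \<sigma> (cyc_embed n f) $$ (i, k) = cyc_embed n (monom 1 i \<star> f) $ k"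
    by (simp add: cyc_rep_def unit_vec_eq_cyc_embed cyc_embed_mult[OF cyclic])
  then show "cyc_rep n \<sigma> (cyc_embed n f) $$ (i, k) = map_mat to_fract (norm_mat f) $$ (i, k)"
    using ik by (simp add: cyc_embed_eq norm_mat_def)
qed (simp_all add: cyc_rep_def norm_mat_def)

lemma det_cyc_rep_embed: "det (cyc_rep n \<sigma> (cyc_embed n f)) = to_fract (poly_norm f)"
  by (simp add: cyc_rep_embed poly_norm_def)

text \<open>Multiplicativity is inherited from the representation \<open>cyc_rep\<close> over the
  field K(x) and pulled back along the injection \<open>to_fract\<close>.\<close>

lemma poly_norm_mult: "poly_norm (f \<star> g) = poly_norm f * poly_norm g"
proof -
  have "to_fract (poly_norm (f \<star> g)) = det (cyc_rep n \<sigma> (cyc_embed n f) * cyc_rep n \<sigma> (cyc_embed n g))"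
    by (simp only: det_cyc_rep_embed[symmetric] cyc_embed_mult[OF cyclic] cyc_rep_mult[OF cyclic])
  also have "\<dots> = to_fract (poly_norm f * poly_norm g)"
    using det_mult[of "cyc_rep n \<sigma> (cyc_embed n f)" n "cyc_rep n \<sigma> (cyc_embed n g)"]
    by (simp add: det_cyc_rep_embed carrier_matI cyc_rep_def[THEN arg_cong[where f = dim_row]]
        cyc_rep_def[THEN arg_cong[where f = dim_col]])
  finally show ?thesis by (simp only: to_fract_eq_iff)
qed

section \<open>Norms of monomials; degree and leading coefficient of the norm\<close>

lemma poly_norm_t: "poly_norm (monom 1 1) = Polynomial.smult ((- 1) ^ (n - 1)) (monom 1 1)"
proof -
  define M where "M = norm_mat (monom 1 1)"
  have [simp]: "dim_row M = n" "dim_col M = n" by (simp_all add: M_def)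
  have entry: "M $$ (i, k) = (if Suc i = k then 1 else if Suc i = n \<and> k = 0 then monom 1 1 else 0)"
    if "i < n" "k < n" for i k
  proof (rule poly_eqI)
    fix e
    have "Suc i = n * e + k \<longleftrightarrow> e = 0 \<and> Suc i = k \<or> e = 1 \<and> Suc i = n \<and> k = 0"
    proof (cases e)
      case (Suc e')
      then show ?thesis using that by (cases e') auto
    qed (use that in auto)
    then show "coeff (M $$ (i, k)) e =
        coeff (if Suc i = k then 1 else if Suc i = n \<and> k = 0 then monom 1 1 else 0) e"
      using that by (auto simp: M_def norm_mat_def coeff_tpart skew_mult_monom coeff_1)
  qed
  \<comment> \<open>The matrix of \<open>t\<close> is a cyclic shift with \<open>x\<close> in its
    lower left corner, which is the only nonzero entry of column 0. Deleting its row and column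
    leaves the identity.\<close>
  have "det M = (\<Sum>i<n. M $$ (i, 0) * cofactor M i 0)"
    using n_pos by (intro laplace_expansion_column) (auto simp: M_def)
  also have "\<dots> = (\<Sum>i<n. if i = n - 1 then monom 1 1 * cofactor M (n - 1) 0 else 0)"
    using n_pos by (intro sum.cong refl) (auto simp: entry)
  also have "\<dots> = monom 1 1 * cofactor M (n - 1) 0" using n_pos by simp
  also have "mat_delete M (n - 1) 0 = 1\<^sub>m (n - 1)"
  proof (rule eq_matI)
    fix i k assume "i < dim_row (1\<^sub>m (n - 1))" "k < dim_col (1\<^sub>m (n - 1))"
    then have ik: "i < n - 1" "k < n - 1" by auto
    then have "mat_delete M (n - 1) 0 $$ (i, k) = M $$ (i, Suc k)"
      by (simp add: mat_delete_def)
    then show "mat_delete M (n - 1) 0 $$ (i, k) = 1\<^sub>m (n - 1) $$ (i, k)"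
      using ik by (auto simp: entry)
  qed auto
  then have "cofactor M (n - 1) 0 = (- 1) ^ (n - 1)" by (simp add: cofactor_def)
  also have "monom 1 1 * (- 1) ^ (n - 1) = Polynomial.smult ((- 1) ^ (n - 1)) (monom (1 :: 'k) 1)"
    by (cases "even (n - 1)") auto
  finally show ?thesis by (simp only: poly_norm_def M_def)
qed

text \<open>Since t^i c = \<sigma>^i(c) t^i, the matrix is diagonal and its entries are the
  conjugates of \<open>c\<close>.\<close>

lemma poly_norm_const: "poly_norm [:c:] = [:galois_norm \<sigma> n c:]"
proof -
  let ?M = "norm_mat [:c:]"
  have entry: "?M $$ (i, k) = (if i = k then [:(\<sigma> ^^ i) c:] else 0)" if "i < n" "k < n" for i k
  proof (rule poly_eqI)
    fix e
    have "i = n * e + k \<longleftrightarrow> e = 0 \<and> i = k" using that by (cases e) auto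
    moreover have "monom 1 i \<star> [:c:] = monom ((\<sigma> ^^ i) c) i"
      using skew_mult_monom[of 1 i c 0] by (simp add: monom_0)
    ultimately show "coeff (?M $$ (i, k)) e = coeff (if i = k then [:(\<sigma> ^^ i) c:] else 0) e"
      using that by (auto simp: norm_mat_def coeff_tpart coeff_pCons split: nat.splits)
  qed
  have "upper_triangular ?M" by (auto simp: entry upper_triangular_def)
  then have "det ?M = prod_list (diag_mat ?M)" by (rule det_upper_triangular[OF _ norm_mat_carrier])
  also have "\<dots> = (\<Prod>i<n. [:(\<sigma> ^^ i) c:])"
    by (simp add: prod_list_diag_prod lessThan_atLeast0 entry)
  also have "\<dots> = [:galois_norm \<sigma> n c:]"
  proof -
    have "(\<Prod>i\<in>S. [:g i:]) = [:\<Prod>i\<in>S. g i:]" for S :: "nat set" and g :: "nat \<Rightarrow> 'k"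
      by (induction S rule: infinite_finite_induct) (auto simp: one_pCons)
    then show ?thesis by (simp add: galois_norm_def)
  qed
  finally show ?thesis by (simp add: poly_norm_def)
qed

lemma poly_norm_monom: "poly_norm (monom c d) = Polynomial.smult ((- 1) ^ ((n - 1) * d) * galois_norm \<sigma> n c) (monom 1 d)"
proof -
  have t: "poly_norm (monom 1 d) = Polynomial.smult ((- 1) ^ ((n - 1) * d)) (monom 1 d)" for d
  proof (induction d)
    case 0
    have "galois_norm \<sigma> n 1 = 1" by (simp add: galois_norm_def)
    then show ?case using poly_norm_const[of 1] by (simp add: monom_0)
  next
    case (Suc d)
    have "monom 1 (Suc d) = monom 1 1 \<star> monom (1 :: 'k) d" by (simp add: skew_mult_monom)
    then show ?case
      by (simp only: poly_norm_mult poly_norm_t Suc) (simp add: mult_monom power_add ac_simps)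
  qed
  have "monom c d = [:c:] \<star> monom 1 d" by (simp add: skew_mult_const_left smult_monom)
  then show ?thesis
    by (simp only: poly_norm_mult poly_norm_const t) (simp add: mult.commute)
qed

lemma poly_norm_top:
  assumes "degree f \<le> d"
  shows "degree (poly_norm f) \<le> d"
    and "coeff (poly_norm f) d = (- 1) ^ ((n - 1) * d) * galois_norm \<sigma> n (coeff f d)"
proof -
  \<comment> \<open>Substituting \<open>t\<^sup>n\<close> for \<open>x\<close> and scaling column \<open>k\<close> by \<open>t\<^sup>k\<close> bounds the degrees in row \<open>i\<close> by
    \<open>d + i\<close>; the matrix \<open>T\<close> of the coefficients at these bounds depends only on the coefficient of
    \<open>f\<close> at \<open>d\<close>, so that \<open>f\<close> can be replaced by a monomial.\<close>
  define T where "T c = mat n n (\<lambda>(i, k). if (d + i) mod n = k then (\<sigma> ^^ i) c else 0)" for c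
  define w where "w = (\<Sum>i<n. i)"
  have *: "degree (poly_norm g) \<le> d \<and> coeff (poly_norm g) d = det (T (coeff g d))"
    if g: "degree g \<le> d" for g
  proof -
    interpret at: comm_ring_hom at_tn
      by unfold_locales (simp_all add: at_tn_mult at_tn_add, simp add: at_tn_def)
    define A where "A = mat n n (\<lambda>(i, k). at_tn (norm_mat g $$ (i, k)) * monom 1 k)"
    have A: "A \<in> carrier_mat n n" by (simp add: A_def)
    have "A = map_mat at_tn (norm_mat g) * mat_diag n (\<lambda>k. monom 1 k)"
      by (subst mat_diag_mult_right[of _ n]) (auto simp: A_def mult.commute)
    moreover have "det (mat_diag n (\<lambda>k. monom (1 :: 'k) k)) = (\<Prod>k<n. monom 1 k)"
      by (subst det_upper_triangular[of _ n])
         (auto simp: upper_triangular_def mat_diag_def prod_list_diag_prod lessThan_atLeast0)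
    moreover have "(\<Prod>k\<in>S. monom (1 :: 'k) k) = monom 1 (\<Sum>k\<in>S. k)" for S
      by (induction S rule: infinite_finite_induct) (auto simp: mult_monom)
    ultimately have det: "det A = at_tn (poly_norm g) * monom 1 w"
      by (simp add: det_mult[of _ n] poly_norm_def w_def)
    \<comment> \<open>Scaling column \<open>k\<close> by t^k puts each term back at its original
      exponent: entry (i, k) is the part of t^i g whose exponents are \<open>k\<close> modulo
      \<open>n\<close>.\<close>
    have entry: "coeff (A $$ (i, k)) j = (if j mod n = k then coeff (monom 1 i \<star> g) j else 0)"
      if ik: "i < n" "k < n" for i k j
    proof -
      have "k \<le> j \<and> n dvd j - k \<longleftrightarrow> j mod n = k"
      proof
        assume "k \<le> j \<and> n dvd j - k"
        then show "j mod n = k" using ik by (metis mod_less mod_nat_eqI)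
      qed (auto simp: minus_mod_eq_mult_div)
      moreover have "n * ((j - k) div n) + k = j" if "j mod n = k"
        using that by (auto simp: minus_mod_eq_mult_div)
      ultimately show ?thesis using ik
        by (auto simp: A_def norm_mat_def mult.commute[of _ "monom 1 k"] coeff_monom_mult
            coeff_at_tn coeff_tpart)
    qed
    have coeff_t: "coeff (monom 1 i \<star> g) j = (if i \<le> j then (\<sigma> ^^ i) (coeff g (j - i)) else 0)" for i j
    proof -
      have "coeff (monom 1 i \<star> g) j =
          (\<Sum>l\<le>j. if l = i then (\<sigma> ^^ i) (coeff g (j - i)) else 0)"
        unfolding coeff_skew_mult by (intro sum.cong refl) auto
      then show ?thesis by simp
    qed
    have deg: "degree (A $$ (i, k)) \<le> d + i" if "i < n" "k < n" for i k
      using g by (intro degree_le allI impI) (auto simp: entry[OF that] coeff_t coeff_eq_0)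
    have top: "mat n n (\<lambda>(i, k). coeff (A $$ (i, k)) (d + i)) = T (coeff g d)"
      unfolding T_def by (intro cong_mat refl) (auto simp: entry coeff_t)
    \<comment> \<open>The surplus \<open>w\<close> of the row bounds is the exponent that the column
      scaling contributes to \<open>det A\<close>. It cancels, leaving \<open>n * d\<close> in t,
      that is \<open>d\<close> in x.\<close>
    have sum: "(\<Sum>i<n. d + i) = n * d + w" by (simp add: sum.distrib w_def)
    have "degree (at_tn (poly_norm g) * monom 1 w) \<le> n * d + w"
      using det_row_degrees(1)[OF A deg] by (simp add: det sum)
    then have "n * degree (poly_norm g) \<le> n * d"
      by (cases "at_tn (poly_norm g) = 0")
         (auto simp: degree_mult_eq degree_monom_eq simp flip: degree_at_tn)
    moreover have "coeff (poly_norm g) d = det (T (coeff g d))"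
      using det_row_degrees(2)[OF A deg] n_pos
      by (simp add: det sum top mult.commute[of _ "monom 1 w"] coeff_monom_mult coeff_at_tn)
    ultimately show ?thesis using n_pos by simp
  qed
  show "degree (poly_norm f) \<le> d" using *[OF assms] by blast
  have "coeff (poly_norm f) d = coeff (poly_norm (monom (coeff f d) d)) d"
    using *[OF assms] *[of "monom (coeff f d) d"] by (simp add: degree_monom_le)
  then show "coeff (poly_norm f) d = (- 1) ^ ((n - 1) * d) * galois_norm \<sigma> n (coeff f d)"
    by (simp add: poly_norm_monom)
qed

lemma galois_norm_eq_0_iff: "galois_norm \<sigma> n c = 0 \<longleftrightarrow> c = 0"
  using n_pos by (auto simp: galois_norm_def)

lemma degree_poly_norm: "degree (poly_norm f) = degree f"
proof (cases "f = 0")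
  case True
  then show ?thesis using poly_norm_const[of 0] galois_norm_eq_0_iff[of 0] by simp
next
  case False
  then have "coeff (poly_norm f) (degree f) \<noteq> 0"
    using poly_norm_top(2)[of f "degree f"] by (simp add: galois_norm_eq_0_iff)
  then show ?thesis using poly_norm_top(1)[of f "degree f"] by (simp add: le_degree antisym)
qed

lemma lead_coeff_poly_norm:
  "lead_coeff (poly_norm f) = (- 1) ^ ((n - 1) * degree f) * galois_norm \<sigma> n (lead_coeff f)"
  using poly_norm_top(2)[of f "degree f"] by (simp add: degree_poly_norm)

lemma poly_norm_eq_0_iff: "poly_norm f = 0 \<longleftrightarrow> f = 0"
  using lead_coeff_poly_norm[of f] by (metis galois_norm_eq_0_iff leading_coeff_0_iff mult_eq_0_iff
      power_not_zero neg_equal_0_iff_equal zero_neq_one)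

text \<open>Conjugation by $t$ applies \<open>\<sigma>\<close> to the coefficients, hence \<open>\<sigma>\<close> fixes the norm.\<close>

lemma poly_norm_fixed: "map_poly \<sigma> (poly_norm f) = poly_norm f"
proof -
  interpret s: map_poly_inj_idom_hom \<sigma> ..
  let ?t = "monom 1 1 :: 'k poly"
  have comm: "?t \<star> f = map_poly \<sigma> f \<star> ?t"
  proof (rule poly_eqI)
    fix j
    have "coeff (?t \<star> f) j = (\<Sum>i\<le>j. if i = 1 then \<sigma> (coeff f (j - 1)) else 0)"
      unfolding coeff_skew_mult by (intro sum.cong refl) auto
    then show "coeff (?t \<star> f) j = coeff (map_poly \<sigma> f \<star> ?t) j"
      unfolding skew_mult_monom_1
      by (simp add: mult.commute[of _ "monom 1 (Suc 0)"] coeff_monom_mult coeff_map_poly)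
  qed
  \<comment> \<open>\<sigma> commutes with its powers, so applying it to the coefficients of
    \<open>f\<close> applies it to every entry of the norm matrix and hence to the
    determinant.\<close>
  have "tpart k (monom 1 i \<star> map_poly \<sigma> f) = map_poly \<sigma> (tpart k (monom 1 i \<star> f))"
    if "k < n" for i k
  proof (rule poly_eqI)
    fix e
    have "coeff (monom 1 i \<star> map_poly \<sigma> f) j = \<sigma> (coeff (monom 1 i \<star> f) j)" for j
      unfolding coeff_skew_mult hom_sum
      by (intro sum.cong refl) (auto simp: coeff_map_poly hom_mult funpow_swap1)
    then show "coeff (tpart k (monom 1 i \<star> map_poly \<sigma> f)) e =
        coeff (map_poly \<sigma> (tpart k (monom 1 i \<star> f))) e"
      using that by (simp add: coeff_tpart coeff_map_poly)
  qed
  then have "norm_mat (map_poly \<sigma> f) = map_mat (map_poly \<sigma>) (norm_mat f)"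
    by (intro eq_matI) (auto simp: norm_mat_def)
  then have "poly_norm (map_poly \<sigma> f) = map_poly \<sigma> (poly_norm f)"
    by (simp add: poly_norm_def)
  \<comment> \<open>Norms of both sides of \<open>comm\<close>. The norm of \<open>t\<close> is
    nonzero and cancels in the commutative ring K[x].\<close>
  moreover have "poly_norm ?t * poly_norm f = poly_norm (map_poly \<sigma> f) * poly_norm ?t"
    by (simp only: poly_norm_mult[symmetric] comm)
  moreover have "poly_norm ?t \<noteq> 0" by (simp add: poly_norm_eq_0_iff)
  ultimately show ?thesis by (simp add: mult.commute)
qed

section \<open>Descent of the norm to F[x]\<close>

abbreviation nrd :: "'k poly \<Rightarrow> 'f poly" where
  "nrd f \<equiv> skew_norm \<iota> \<sigma> n f"

text \<open>The coefficients of \<open>poly_norm f\<close> are fixed by \<sigma>, hence come from F.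
  The polynomial over F obtained this way meets both definite descriptions behind
  \<open>skew_norm\<close>, uniquely because \<open>fract_map \<iota>\<close> and
  \<open>to_fract\<close> are injective.\<close>

lemma map_nrd: "map_poly \<iota> (nrd f) = poly_norm f"
proof -
  interpret fi: field_hom "fract_map \<iota>" by (intro field_hom_fract_map base.field_hom_axioms)
  have "\<sigma> (coeff (poly_norm f) i) = coeff (poly_norm f) i" for i
    using arg_cong[OF poly_norm_fixed, of "\<lambda>p. coeff p i" f] by (simp add: coeff_map_poly)
  then have "\<forall>i. \<exists>b. coeff (poly_norm f) i = \<iota> b" using fixed_in_base by blast
  then obtain b where b: "\<And>i. coeff (poly_norm f) i = \<iota> (b i)" by metis
  define q where "q = (\<Sum>i\<le>degree (poly_norm f). monom (b i) i)"
  have "map_poly \<iota> q = poly_norm f"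
  proof (rule poly_eqI)
    fix i
    have "\<iota> (b i) = 0" if "degree (poly_norm f) < i" using that b coeff_eq_0 by metis
    then show "coeff (map_poly \<iota> q) i = coeff (poly_norm f) i"
      by (auto simp: q_def coeff_map_poly coeff_sum b not_le)
  qed
  moreover have "nrd f = q" if "map_poly \<iota> q = poly_norm f" for q
  proof -
    have fq: "fract_map \<iota> (to_fract q) = det (cyc_rep n \<sigma> (cyc_embed n f))"
      using that by (simp add: det_cyc_rep_embed to_fract_def fract_map_Fract base.field_hom_axioms)
    have "reduced_norm \<iota> \<sigma> n (cyc_embed n f) = to_fract q"
      unfolding reduced_norm_def using fq by (intro the_equality) (auto simp flip: fq)
    then show ?thesis by (simp add: skew_norm_def)
  qed
  ultimately show ?thesis by blast
qed

lemma map_poly_base_inj: "map_poly \<iota> p = map_poly \<iota> q \<longleftrightarrow> p = q"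
  by simp

lemma nrd_mult: "nrd (f \<star> g) = nrd f * nrd g"
  by (simp only: map_poly_base_inj[symmetric] map_nrd base_poly.hom_mult poly_norm_mult)

lemma degree_nrd: "degree (nrd f) = degree f"
  using degree_poly_norm[of f] by (simp flip: map_nrd)

lemma lead_coeff_nrd:
  "\<iota> (lead_coeff (nrd f)) = (- 1) ^ ((n - 1) * degree f) * galois_norm \<sigma> n (lead_coeff f)"
  using lead_coeff_poly_norm[of f] by (simp add: coeff_map_poly degree_nrd flip: map_nrd)

lemma nrd_eq_0_iff: "nrd f = 0 \<longleftrightarrow> f = 0"
  using poly_norm_eq_0_iff[of f] by (simp flip: map_nrd)

text \<open>The first row of the adjugate of \<open>norm_mat f\<close> is the cofactor.\<close>

lemma right_divides_nrd: "right_divides \<sigma> f (eval_at_tn \<iota> n (nrd f))"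
proof -
  let ?M = "norm_mat f"
  define c where "c i = adj_mat ?M $$ (0, i)" for i
  have row: "(\<Sum>i<n. c i * ?M $$ (i, k)) = (if k = 0 then poly_norm f else 0)" if "k < n" for k
  proof -
    have "(adj_mat ?M * ?M) $$ (0, k) = (\<Sum>i<n. c i * ?M $$ (i, k))"
      using that n_pos adj_mat(1)[OF norm_mat_carrier, of f]
      by (auto simp: c_def scalar_prod_def lessThan_atLeast0 intro!: sum.cong)
    then show ?thesis
      using that n_pos by (auto simp: adj_mat(3)[OF norm_mat_carrier] poly_norm_def)
  qed
  \<comment> \<open>\<open>g\<close> has the coordinates \<open>c i\<close>, so the coordinates of
    \<open>g \<star> f\<close> are the row \<open>c\<close> times \<open>norm_mat f\<close>; by
    \<open>row\<close> only the one at t^0 survives.\<close>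
  define g where "g = (\<Sum>i<n. at_tn (c i) * monom 1 i)"
  have "g \<star> f = (\<Sum>i<n. at_tn (c i) * (monom 1 i \<star> f))"
    by (simp add: g_def skew_mult_sum_left at_tn_mult_assoc)
  also have "\<dots> = (\<Sum>i<n. at_tn (c i) * (\<Sum>k<n. at_tn (?M $$ (i, k)) * monom 1 k))"
  proof (intro sum.cong refl)
    fix i assume "i \<in> {..<n}"
    then have "(\<Sum>k<n. at_tn (?M $$ (i, k)) * monom 1 k) =
        (\<Sum>k<n. at_tn (tpart k (monom 1 i \<star> f)) * monom 1 k)"
      by (intro sum.cong refl) (simp add: norm_mat_def)
    then show "at_tn (c i) * (monom 1 i \<star> f) =
        at_tn (c i) * (\<Sum>k<n. at_tn (?M $$ (i, k)) * monom 1 k)"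
      by (simp add: tpart_decomposition)
  qed
  also have "\<dots> = (\<Sum>i<n. \<Sum>k<n. at_tn (c i * ?M $$ (i, k)) * monom 1 k)"
    by (simp add: sum_distrib_left at_tn_mult mult.assoc)
  also have "\<dots> = (\<Sum>k<n. \<Sum>i<n. at_tn (c i * ?M $$ (i, k)) * monom 1 k)"
    by (rule sum.swap)
  also have "\<dots> = (\<Sum>k<n. at_tn (\<Sum>i<n. c i * ?M $$ (i, k)) * monom 1 k)"
    by (simp add: at_tn_sum sum_distrib_right)
  also have "\<dots> = (\<Sum>k<n. if k = 0 then at_tn (poly_norm f) else 0)"
    by (intro sum.cong refl) (auto simp: row)
  also have "\<dots> = eval_at_tn \<iota> n (nrd f)"
    using n_pos by (simp add: eval_at_tn_eq map_nrd)
  finally show ?thesis unfolding right_divides_def by (intro exI[of _ g]) (rule sym)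
qed

end

section \<open>Polynomials over a field\<close>

text \<open>Associatedness in the polynomial ring, with the nonzero constant explicit as in the
  theorem.\<close>

definition proportional :: "'a::field poly \<Rightarrow> 'a poly \<Rightarrow> bool" where
  "proportional p q \<longleftrightarrow> (\<exists>c. c \<noteq> 0 \<and> p = Polynomial.smult c q)"

lemma proportional_refl: "proportional p p"
  unfolding proportional_def by (intro exI[of _ 1]) simp

lemma proportional_sym: "proportional p q \<Longrightarrow> proportional q p"
  unfolding proportional_def
proof (elim exE conjE)
  fix c assume "c \<noteq> 0" "p = Polynomial.smult c q"
  then show "\<exists>c. c \<noteq> 0 \<and> q = Polynomial.smult c p" by (intro exI[of _ "1 / c"]) simp
qed

lemma proportional_trans:
  assumes "proportional p q" "proportional q r"
  shows "proportional p r"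
proof -
  obtain c d where "c \<noteq> 0" "p = Polynomial.smult c q" "d \<noteq> 0" "q = Polynomial.smult d r"
    using assms unfolding proportional_def by blast
  then show ?thesis unfolding proportional_def by (intro exI[of _ "c * d"]) simp
qed

lemma proportional_degree: "proportional p q \<Longrightarrow> degree p = degree q"
  by (auto simp: proportional_def)

lemma proportional_nth_eq:
  assumes "\<forall>i<length hs. \<forall>j<length hs. i \<noteq> j \<longrightarrow> \<not> (\<exists>c. hs ! i = Polynomial.smult c (hs ! j))"
    and "i < length hs" "j < length hs" "proportional (hs ! i) (hs ! j)"
  shows "i = j"
  using assms unfolding proportional_def by metis

lemma proportional_cancel:
  assumes "proportional (a * p) (b * q)" "proportional a b" "b \<noteq> 0"
  shows "proportional p q"
proof -
  obtain c d where c: "c \<noteq> 0" "a * p = Polynomial.smult c (b * q)"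
    and d: "d \<noteq> 0" "a = Polynomial.smult d b"
    using assms unfolding proportional_def by blast
  have "b * Polynomial.smult d p = b * Polynomial.smult c q" using c d by simp
  then have "Polynomial.smult d p = Polynomial.smult c q" using assms(3) mult_cancel_left by blast
  then have "Polynomial.smult (1 / d) (Polynomial.smult d p) = Polynomial.smult (1 / d) (Polynomial.smult c q)"
    by simp
  then have "p = Polynomial.smult (c / d) q" using d by simp
  then show ?thesis unfolding proportional_def using c d by (intro exI[of _ "c / d"]) simp
qed

lemma irreducible_dvd_proportional:
  fixes p q :: "'a::field poly"
  assumes "Factorial_Ring.irreducible p" "q dvd p" "\<not> is_unit q"
  shows "proportional q p"
proof -
  obtain r where r: "p = q * r" using assms(2) by blast
  then have "is_unit r" using assms(1,3) irreducibleD by blast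
  moreover have "r \<noteq> 0" using assms(1) r by auto
  ultimately have "degree r = 0" using is_unit_iff_degree by blast
  then obtain c where c: "r = [:c:]" by (rule degree_eq_zeroE)
  then have "c \<noteq> 0" using \<open>r \<noteq> 0\<close> by simp
  then have "q = Polynomial.smult (1 / c) p" using r c by simp
  then show ?thesis unfolding proportional_def using \<open>c \<noteq> 0\<close> by (intro exI[of _ "1 / c"]) simp
qed

lemma prime_elem_dvd_prod_list: "prime_elem p \<Longrightarrow> p dvd prod_list bs \<Longrightarrow> \<exists>b\<in>set bs. p dvd b"
proof (induction bs)
  case Nil
  then show ?case by (simp add: prime_elem_not_unit)
next
  case (Cons b bs)
  then show ?case using prime_elem_dvd_mult_iff by auto
qed

text \<open>\<open>cs\<close> is \<open>bs\<close> rearranged to match \<open>as\<close>. The head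
  of \<open>as\<close> is prime, so it divides some member of \<open>bs\<close>, is proportional to
  it, and both cancel from the products.\<close>

lemma irreducible_factorization_unique:
  fixes as bs :: "'a::field poly list"
  assumes "\<forall>a\<in>set as. Factorial_Ring.irreducible a" "\<forall>b\<in>set bs. Factorial_Ring.irreducible b"
    and "proportional (prod_list as) (prod_list bs)"
  shows "\<exists>cs. mset cs = mset bs \<and> list_all2 proportional as cs"
  using assms
proof (induction as arbitrary: bs)
  case Nil
  have "degree (prod_list bs) = 0" using proportional_degree[OF Nil(3)] by simp
  moreover have "prod_list bs \<noteq> 0" using Nil(2) by (auto simp: prod_list_zero_iff)
  ultimately have "is_unit (prod_list bs)" by (simp add: is_unit_iff_degree)
  then have "is_unit b" if "bs = b # bs'" for b bs'
    using that by (metis dvd_mult_left prod_list.Cons)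
  then have "bs = []" using Nil(2) irreducible_not_unit by (metis list.set_intros(1) neq_Nil_conv)
  then show ?case by simp
next
  case (Cons a as)
  obtain c where "prod_list (a # as) = Polynomial.smult c (prod_list bs)" "c \<noteq> 0"
    using Cons.prems(3) by (auto simp: proportional_def)
  then have "a dvd Polynomial.smult c (prod_list bs)" by (metis dvd_triv_left prod_list.Cons)
  then have "a dvd prod_list bs" using \<open>c \<noteq> 0\<close> by (simp add: dvd_smult_iff)
  moreover have a: "Factorial_Ring.irreducible a" using Cons.prems by simp
  ultimately obtain b where b: "b \<in> set bs" "a dvd b"
    using prime_elem_dvd_prod_list field_poly_irreducible_imp_prime by blast
  have ab: "proportional a b"
    using irreducible_dvd_proportional[of b a] b Cons.prems(2) a by (auto simp: irreducible_not_unit)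
  have ms: "mset bs = mset (b # remove1 b bs)" using b by simp
  then have "prod_list bs = b * prod_list (remove1 b bs)" by (metis prod_mset_prod_list prod_list.Cons)
  moreover have "b \<noteq> 0" using b Cons.prems(2) by auto
  ultimately have "proportional (prod_list as) (prod_list (remove1 b bs))"
    using Cons.prems(3) ab proportional_cancel by (metis prod_list.Cons)
  moreover have "\<forall>b\<in>set (remove1 b bs). Factorial_Ring.irreducible b"
    using Cons.prems(2) set_remove1_subset by fastforce
  ultimately obtain cs where cs: "mset cs = mset (remove1 b bs)" "list_all2 proportional as cs"
    using Cons.IH Cons.prems(1) by (metis list.set_intros(2))
  have "mset (b # cs) = mset bs" using cs(1) by (simp only: ms mset.simps)
  then show ?case using cs(2) ab by (intro exI[of _ "b # cs"]) simp
qed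

section \<open>Norms and factorizations\<close>

context skew_poly
begin

text \<open>The left ideal Rf + Rb is principal. Its generator is a greatest common right divisor,
  with Bezout coefficients from membership in the ideal.\<close>

lemma right_bezout:
  assumes "f \<noteq> 0"
  obtains d u v where "d \<noteq> 0" "right_divides \<sigma> d f" "right_divides \<sigma> d b" "d = u \<star> f + v \<star> b"
proof -
  define J where "J = {p. \<exists>u v. p = u \<star> f + v \<star> b}"
  have "p - q \<in> J" if pq: "p \<in> J" "q \<in> J" for p q
  proof -
    obtain u v u' v' where "p = u \<star> f + v \<star> b" "q = u' \<star> f + v' \<star> b"
      using pq unfolding J_def by blast
    then have "p - q = (u - u') \<star> f + (v - v') \<star> b" by (simp add: skew_mult_diff_left)
    then show ?thesis unfolding J_def by blast
  qed
  moreover have "p \<star> q \<in> J" if q: "q \<in> J" for p q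
  proof -
    obtain u v where "q = u \<star> f + v \<star> b" using q unfolding J_def by blast
    then have "p \<star> q = (p \<star> u) \<star> f + (p \<star> v) \<star> b"
      by (simp add: skew_mult_add_right skew_mult_assoc)
    then show ?thesis unfolding J_def by blast
  qed
  moreover have "f = 1 \<star> f + 0 \<star> b" "b = 0 \<star> f + 1 \<star> b" by simp_all
  then have "f \<in> J" "b \<in> J" unfolding J_def by blast+
  ultimately obtain d where "d \<in> J" "d \<noteq> 0" "right_divides \<sigma> d f" "right_divides \<sigma> d b"
    using left_ideal_principal[of J f] assms by metis
  then show ?thesis using that by (auto simp: J_def)
qed

lemma right_bezout_coprime:
  assumes "d = u \<star> f + v \<star> b" "degree d = 0" "d \<noteq> 0"
  obtains u' v' where "1 = u' \<star> f + v' \<star> b"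
proof -
  obtain e where "e \<star> d = 1" using assms skew_unit_iff[of d] by (auto simp: skew_unit_def)
  then have "1 = (e \<star> u) \<star> f + (e \<star> v) \<star> b"
    using assms(1) by (simp add: skew_mult_add_right skew_mult_assoc)
  then show ?thesis using that by blast
qed

end

section \<open>Elements whose norm is their minimal central left multiple\<close>

context cyclic_algebra
begin

lemma nrd_1 [simp]: "nrd 1 = 1"
proof -
  have "nrd 1 * nrd 1 = nrd 1 * 1" using nrd_mult[of 1 1] by simp
  then show ?thesis using nrd_eq_0_iff[of 1] by (simp only: mult_left_cancel one_neq_zero not_False_eq_True)
qed

lemma nrd_skew_prod: "nrd (skew_prod \<sigma> gs) = prod_list (map nrd gs)"
  by (induction gs) (simp_all add: nrd_mult)

text \<open>As \<open>f\<close> divides its norm, this says that the norm is the minimal central left multiple of \<open>f\<close>.\<close>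

definition nrd_minimal :: "'k poly \<Rightarrow> bool" where
  "nrd_minimal f \<longleftrightarrow> f \<noteq> 0 \<and>
     (\<forall>p. p \<noteq> 0 \<and> right_divides \<sigma> f (eval_at_tn \<iota> n p) \<longrightarrow> degree f \<le> degree p)"

text \<open>If p(t^n) = wa and N(b)(t^n) = vb, centrality of p(t^n) gives (p N(b))(t^n) = vwab, so
  \<open>degree a + degree b\<close> is at most \<open>degree p + degree b\<close>. The argument for
  \<open>b\<close> multiplies by N(a) instead.\<close>

lemma nrd_minimal_factors:
  assumes "nrd_minimal (a \<star> b)"
  shows "nrd_minimal a" "nrd_minimal b"
proof -
  have nz: "a \<noteq> 0" "b \<noteq> 0" using assms by (auto simp: nrd_minimal_def)
  note deg = degree_skew_mult[OF nz]
  have min: "degree a + degree b \<le> degree p"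
    if "p \<noteq> 0" "eval_at_tn \<iota> n p = w \<star> (a \<star> b)" for p w
    using assms that unfolding nrd_minimal_def right_divides_def deg by blast
  obtain u where u: "eval_at_tn \<iota> n (nrd a) = u \<star> a"
    using right_divides_nrd[of a] unfolding right_divides_def by blast
  obtain v where v: "eval_at_tn \<iota> n (nrd b) = v \<star> b"
    using right_divides_nrd[of b] unfolding right_divides_def by blast
  show "nrd_minimal a"
    unfolding nrd_minimal_def
  proof (intro conjI nz allI impI, elim conjE)
    fix p assume p: "p \<noteq> 0" "right_divides \<sigma> a (eval_at_tn \<iota> n p)"
    then obtain w where w: "eval_at_tn \<iota> n p = w \<star> a" by (auto simp: right_divides_def)
    have "eval_at_tn \<iota> n (p * nrd b) = (eval_at_tn \<iota> n p \<star> v) \<star> b"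
      by (simp only: eval_at_tn_mult v skew_mult_assoc)
    also have "\<dots> = (v \<star> eval_at_tn \<iota> n p) \<star> b" by (simp only: eval_at_tn_commute)
    also have "\<dots> = (v \<star> w) \<star> (a \<star> b)" by (simp only: w skew_mult_assoc)
    finally have "degree a + degree b \<le> degree (p * nrd b)"
      using p nz by (intro min) (simp_all add: nrd_eq_0_iff)
    then show "degree a \<le> degree p" using p nz by (simp add: degree_mult_eq nrd_eq_0_iff degree_nrd)
  qed
  show "nrd_minimal b"
    unfolding nrd_minimal_def
  proof (intro conjI nz allI impI, elim conjE)
    fix p assume p: "p \<noteq> 0" "right_divides \<sigma> b (eval_at_tn \<iota> n p)"
    then obtain w where w: "eval_at_tn \<iota> n p = w \<star> b" by (auto simp: right_divides_def)
    have "eval_at_tn \<iota> n (nrd a * p) = (eval_at_tn \<iota> n (nrd a) \<star> w) \<star> b"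
      by (simp only: eval_at_tn_mult w skew_mult_assoc)
    also have "\<dots> = (w \<star> eval_at_tn \<iota> n (nrd a)) \<star> b" by (simp only: eval_at_tn_commute)
    also have "\<dots> = (w \<star> u) \<star> (a \<star> b)" by (simp only: u skew_mult_assoc)
    finally have "degree a + degree b \<le> degree (nrd a * p)"
      using p nz by (intro min) (simp_all add: nrd_eq_0_iff)
    then show "degree b \<le> degree p" using p nz by (simp add: degree_mult_eq nrd_eq_0_iff degree_nrd)
  qed
qed

lemma nrd_minimal_right_divisor: "nrd_minimal f \<Longrightarrow> right_divides \<sigma> g f \<Longrightarrow> nrd_minimal g"
  using nrd_minimal_factors(2) by (auto simp: right_divides_def)

lemma nrd_minimal_skew_prod: "nrd_minimal (skew_prod \<sigma> gs) \<Longrightarrow> g \<in> set gs \<Longrightarrow> nrd_minimal g"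
  by (induction gs) (auto dest: nrd_minimal_factors)

lemma right_divides_eval_at_tn_mult:
  "right_divides \<sigma> g (eval_at_tn \<iota> n p) \<Longrightarrow> right_divides \<sigma> g (eval_at_tn \<iota> n (q * p))"
  by (simp only: eval_at_tn_mult right_divides_mult)

text \<open>The remainder of \<open>p\<close> modulo N(g) still gives a central multiple of
  \<open>g\<close>, but has degree below \<open>degree g\<close>; minimality forces it to
  vanish.\<close>

lemma nrd_dvd:
  assumes "nrd_minimal g" "right_divides \<sigma> g (eval_at_tn \<iota> n p)"
  shows "nrd g dvd p"
proof (rule ccontr)
  assume "\<not> nrd g dvd p"
  then have nz: "p mod nrd g \<noteq> 0" by (simp add: dvd_eq_mod_eq_0)
  have g: "nrd g \<noteq> 0" using assms(1) by (simp add: nrd_minimal_def nrd_eq_0_iff)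
  have "p mod nrd g = p - (p div nrd g) * nrd g" by (rule minus_div_mult_eq_mod[symmetric])
  then have "right_divides \<sigma> g (eval_at_tn \<iota> n (p mod nrd g))"
    using assms(2) right_divides_eval_at_tn_mult[OF right_divides_nrd] right_divides_diff
    by (simp only: eval_at_tn_diff)
  then have "degree g \<le> degree (p mod nrd g)" using assms(1) nz by (simp add: nrd_minimal_def)
  then show False using degree_mod_less[OF g, of p] nz by (simp add: degree_nrd)
qed

text \<open>A Euclid lemma: multiply 1 = uf + vb(t^n) by a(t^n) on the left. As a(t^n) is central it
  passes \<open>v\<close>, so both summands lie in Rf.\<close>

lemma right_divides_cofactor:
  assumes "d = u \<star> f + v \<star> eval_at_tn \<iota> n b" "degree d = 0" "d \<noteq> 0"
    and "right_divides \<sigma> f (eval_at_tn \<iota> n (a * b))"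
  shows "right_divides \<sigma> f (eval_at_tn \<iota> n a)"
proof -
  let ?a = "eval_at_tn \<iota> n a" and ?b = "eval_at_tn \<iota> n b"
  obtain u v where uv: "1 = u \<star> f + v \<star> ?b" using right_bezout_coprime[OF assms(1-3)] by blast
  obtain w where w: "?a \<star> ?b = w \<star> f"
    using assms(4) unfolding eval_at_tn_mult right_divides_def by blast
  have "?a = ?a \<star> (u \<star> f + v \<star> ?b)" by (simp flip: uv)
  also have "\<dots> = (?a \<star> u) \<star> f + (?a \<star> v) \<star> ?b" by (simp only: skew_mult_add_right skew_mult_assoc)
  also have "(?a \<star> v) \<star> ?b = v \<star> (?a \<star> ?b)"
    by (simp only: eval_at_tn_commute[of a v] skew_mult_assoc)
  also have "(?a \<star> u) \<star> f + v \<star> (?a \<star> ?b) = (?a \<star> u + v \<star> w) \<star> f"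
    by (simp only: w skew_mult_add_left skew_mult_assoc)
  finally show ?thesis unfolding right_divides_def by blast
qed

text \<open>If N(f) = ab, a greatest common right divisor of \<open>f\<close> and b(t^n) is a
  constant or a constant multiple of \<open>f\<close>. So \<open>f\<close> right-divides a(t^n) or
  b(t^n), and by minimality that factor has the full degree.\<close>

lemma irreducible_nrd:
  assumes "nrd_minimal f" "skew_irreducible \<sigma> f"
  shows "Factorial_Ring.irreducible (nrd f)"
proof (rule irreducibleI)
  have f: "f \<noteq> 0" "1 \<le> degree f" using assms by (auto simp: nrd_minimal_def skew_irreducible_iff)
  show nz: "nrd f \<noteq> 0" using f by (simp add: nrd_eq_0_iff)
  show "\<not> is_unit (nrd f)" using f nz by (simp add: is_unit_iff_degree degree_nrd)
  fix a b assume ab: "nrd f = a * b"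
  then have nzab: "a \<noteq> 0" "b \<noteq> 0" using nz by auto
  then have deg: "degree f = degree a + degree b"
    using arg_cong[OF ab, of degree] by (simp add: degree_mult_eq degree_nrd)
  let ?a = "eval_at_tn \<iota> n a" and ?b = "eval_at_tn \<iota> n b"
  obtain d u v where d: "d \<noteq> 0" "right_divides \<sigma> d f" "right_divides \<sigma> d ?b" "d = u \<star> f + v \<star> ?b"
    using right_bezout[OF f(1)] by blast
  obtain e where e: "f = e \<star> d" using d by (auto simp: right_divides_def)
  have "right_divides \<sigma> f ?a \<or> right_divides \<sigma> f ?b"
  proof (cases "degree d = 0")
    case True
    then have "right_divides \<sigma> f ?a"
      using right_divides_cofactor[OF d(4)] d(1) right_divides_nrd[of f] ab by metis
    then show ?thesis ..
  next
    case False
    have "degree e = 0 \<or> degree d = 0" using assms(2) e unfolding skew_irreducible_iff by metis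
    then have "degree e = 0" using False by blast
    moreover have "e \<noteq> 0" using e f by auto
    ultimately have "degree d = degree f" using degree_skew_mult[of e d] d(1) e by simp
    then obtain c where "c \<noteq> 0" "f = Polynomial.smult c d"
      using right_divides_same_degree[OF d(2) f(1)] by blast
    then have "d = [:1 / c:] \<star> f" by (simp add: skew_mult_const_left)
    then have "right_divides \<sigma> f d" unfolding right_divides_def by blast
    then show ?thesis using d(3) right_divides_trans by blast
  qed
  then have "degree f \<le> degree a \<or> degree f \<le> degree b"
    using assms(1) nzab by (auto simp: nrd_minimal_def)
  then have "degree a = 0 \<or> degree b = 0" using deg by auto
  then show "is_unit a \<or> is_unit b" using nzab by (simp add: is_unit_iff_degree)
qed

lemma ex_factor_with_nrd:
  assumes f: "nrd_minimal f" and p: "Factorial_Ring.irreducible p" "p dvd nrd f"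
  obtains f' g where "f = f' \<star> g" "skew_irreducible \<sigma> g" "lead_coeff g = 1" "proportional (nrd g) p"
proof -
  have f0: "f \<noteq> 0" using f by (simp add: nrd_minimal_def)
  obtain q where q: "nrd f = q * p" using p(2) by (metis dvdE mult.commute)
  have nz: "q \<noteq> 0" "p \<noteq> 0" using q f0 nrd_eq_0_iff[of f] by auto
  have degp: "0 < degree p" using p(1) nz irreducible_not_unit is_unit_iff_degree by blast
  let ?p = "eval_at_tn \<iota> n p" and ?q = "eval_at_tn \<iota> n q"
  obtain d u v where d: "d \<noteq> 0" "right_divides \<sigma> d f" "right_divides \<sigma> d ?p" "d = u \<star> f + v \<star> ?p"
    using right_bezout[OF f0] by blast
  have "degree d \<noteq> 0"
  proof
    assume "degree d = 0"
    then have "right_divides \<sigma> f ?q"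
      using right_divides_cofactor[OF d(4)] d(1) right_divides_nrd[of f] q by metis
    then have "degree f \<le> degree q" using f nz by (simp add: nrd_minimal_def)
    moreover have "degree f = degree q + degree p"
      using arg_cong[OF q, of degree] nz by (simp add: degree_mult_eq degree_nrd)
    ultimately show False using degp by simp
  qed
  then obtain g where g: "skew_irreducible \<sigma> g" "lead_coeff g = 1" "right_divides \<sigma> g d"
    using ex_irreducible_right_factor[of d] by auto
  have gf: "right_divides \<sigma> g f" and gp: "right_divides \<sigma> g ?p"
    using right_divides_trans g(3) d by blast+
  \<comment> \<open>\<open>g\<close> inherits minimality from \<open>f\<close> and right-divides
    p(t^n), so N(g) divides \<open>p\<close>. Not being a unit, it is \<open>p\<close> up to a
    constant.\<close>
  have "\<not> is_unit (nrd g)"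
    using g(1) by (auto simp: is_unit_iff_degree skew_irreducible_iff degree_nrd nrd_eq_0_iff)
  then have "proportional (nrd g) p"
    using irreducible_dvd_proportional p(1) nrd_dvd nrd_minimal_right_divisor f gf gp by blast
  then show ?thesis using that g gf by (auto simp: right_divides_def)
qed

text \<open>Both divisors agree with a generator of \<open>Rg \<inter> Rg'\<close>: it divides \<open>f\<close>, so its degree is at most
  that of the central element \<open>nrd g\<close> in the intersection.\<close>

lemma right_factor_unique:
  assumes f: "nrd_minimal f" "right_divides \<sigma> g f" "right_divides \<sigma> g' f"
    and monic: "lead_coeff g = 1" "lead_coeff g' = 1"
    and assoc: "proportional (nrd g) (nrd g')"
  shows "g = g'"
proof -
  have f0: "f \<noteq> 0" using f by (simp add: nrd_minimal_def)
  define J where "J = {q. right_divides \<sigma> g q \<and> right_divides \<sigma> g' q}"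
  obtain L where L: "L \<in> J" "L \<noteq> 0" "\<And>p. p \<in> J \<Longrightarrow> right_divides \<sigma> L p"
  proof (rule left_ideal_principal[of J f])
    show "p - q \<in> J" if "p \<in> J" "q \<in> J" for p q
      using that by (simp add: J_def right_divides_diff)
    show "p \<star> q \<in> J" if "q \<in> J" for p q
      using that by (simp add: J_def right_divides_mult)
    show "f \<in> J" using f by (simp add: J_def)
  qed (use f0 in auto)
  \<comment> \<open>The norms differ by a constant, so N(g)(t^n) lies in both Rg and Rg'.\<close>
  obtain c where "nrd g = [:c:] * nrd g'" using assoc by (auto simp: proportional_def)
  then have "right_divides \<sigma> g' (eval_at_tn \<iota> n (nrd g))"
    by (simp only: right_divides_eval_at_tn_mult right_divides_nrd)
  then have "eval_at_tn \<iota> n (nrd g) \<in> J" by (simp add: J_def right_divides_nrd)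
  moreover have "g \<noteq> 0" "g' \<noteq> 0" using monic by auto
  moreover have "nrd_minimal L" using nrd_minimal_right_divisor[OF f(1)] L(3) f by (simp add: J_def)
  ultimately have le: "degree L \<le> degree g"
    using L(3) by (auto simp: nrd_minimal_def nrd_eq_0_iff simp flip: degree_nrd)
  have deg: "degree g = degree g'" using proportional_degree[OF assoc] by (simp add: degree_nrd)
  \<comment> \<open>A right divisor of \<open>L\<close> of degree at least \<open>degree L\<close>
    is a constant multiple of \<open>L\<close>; hence both \<open>g\<close> and \<open>g'\<close>
    are the monic normalization of \<open>L\<close>.\<close>
  have eq: "h = Polynomial.smult (1 / lead_coeff L) L"
    if h: "right_divides \<sigma> h L" "lead_coeff h = 1" "degree h = degree g" for h
  proof -
    obtain e where e: "L = e \<star> h" using h by (auto simp: right_divides_def)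
    then have "e \<noteq> 0" "h \<noteq> 0" using L by auto
    then have "degree h = degree L" using e le h by (simp add: degree_skew_mult)
    then obtain c where "c \<noteq> 0" "L = Polynomial.smult c h"
      using right_divides_same_degree[OF h(1) L(2)] by blast
    then show ?thesis using h(2) by simp
  qed
  have "right_divides \<sigma> g L" "right_divides \<sigma> g' L" using L(1) by (simp_all add: J_def)
  from eq[OF this(1) monic(1) refl] eq[OF this(2) monic(2) deg[symmetric]] show ?thesis by (simp only:)
qed

section \<open>Existence and uniqueness for a prescribed order of the norms\<close>

lemma ex_decomposition:
  assumes "nrd_minimal f" "lead_coeff f = 1" "\<forall>h\<in>set hs. Factorial_Ring.irreducible h"
    and "proportional (nrd f) (prod_list hs)"
  shows "\<exists>fs\<in>monic_irreducible_decompositions \<sigma> f. list_all2 (\<lambda>g h. proportional (nrd g) h) fs hs"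
  using assms
\<comment> \<open>Irreducible factors split off on the right, hence the induction from the end of
  \<open>hs\<close>. The left cofactor is again monic with minimal norm.\<close>
proof (induction hs arbitrary: f rule: rev_induct)
  case Nil
  then have "degree f = 0" using proportional_degree[OF Nil(4)] by (simp add: degree_nrd)
  then have "f = 1" using Nil(2) by (metis degree_eq_zeroE lead_coeff_pCons(2) one_pCons)
  then show ?case by (simp add: monic_irreducible_decompositions_def)
next
  case (snoc h hs)
  have h: "Factorial_Ring.irreducible h" using snoc.prems by simp
  obtain c where "nrd f = Polynomial.smult c (prod_list hs * h)"
    using snoc.prems(4) by (auto simp: proportional_def)
  then have "h dvd nrd f" by (simp add: dvd_smult)
  then obtain f' g where g: "f = f' \<star> g" "skew_irreducible \<sigma> g" "lead_coeff g = 1"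
      "proportional (nrd g) h"
    using ex_factor_with_nrd[OF snoc.prems(1) h] by blast
  have "nrd_minimal f'" using nrd_minimal_factors snoc.prems(1) g(1) by blast
  moreover have "lead_coeff f' = 1" using monic_left_factor g snoc.prems(2) by blast
  moreover have "proportional (nrd f') (prod_list hs)"
  proof (rule proportional_cancel)
    show "proportional (nrd g * nrd f') (h * prod_list hs)"
      using snoc.prems(4) g(1) by (simp add: nrd_mult mult.commute)
  qed (use g h in auto)
  ultimately obtain fs where fs: "fs \<in> monic_irreducible_decompositions \<sigma> f'"
      "list_all2 (\<lambda>g h. proportional (nrd g) h) fs hs"
    using snoc.IH[of f'] snoc.prems(3) by auto
  show ?case
    using fs g by (intro bexI[of _ "fs @ [g]"])
      (auto simp: monic_irreducible_decompositions_def skew_prod_append list_all2_appendI)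
qed

text \<open>The last factors are monic right divisors of the same element with proportional norms,
  so they agree by \<open>right_factor_unique\<close>. They cancel, and the remaining left product
  keeps minimality.\<close>

lemma decomposition_unique:
  assumes "nrd_minimal (skew_prod \<sigma> fs)" "skew_prod \<sigma> fs = skew_prod \<sigma> gs"
    and "\<forall>g\<in>set fs. lead_coeff g = 1" "\<forall>g\<in>set gs. lead_coeff g = 1"
    and "list_all2 (\<lambda>g h. proportional (nrd g) (nrd h)) fs gs"
  shows "fs = gs"
  using assms
proof (induction fs arbitrary: gs rule: rev_induct)
  case (snoc g fs)
  obtain gs' g' where gs: "gs = gs' @ [g']"
    using snoc.prems(5) by (cases gs rule: rev_cases) auto
  have all: "list_all2 (\<lambda>g h. proportional (nrd g) (nrd h)) fs gs'" "proportional (nrd g) (nrd g')"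
    using snoc.prems(5) list_all2_lengthD[OF snoc.prems(5)] by (auto simp: gs list_all2_append)
  have f: "skew_prod \<sigma> (fs @ [g]) = skew_prod \<sigma> fs \<star> g"
      "skew_prod \<sigma> (fs @ [g]) = skew_prod \<sigma> gs' \<star> g'"
    using snoc.prems(2) by (simp_all add: skew_prod_append gs)
  have "right_divides \<sigma> g (skew_prod \<sigma> (fs @ [g]))" "right_divides \<sigma> g' (skew_prod \<sigma> (fs @ [g]))"
    using f unfolding right_divides_def by blast+
  from right_factor_unique[OF snoc.prems(1) this _ _ all(2)] have "g = g'"
    using snoc.prems(3,4) by (simp add: gs)
  moreover have "g \<noteq> 0" using snoc.prems(3) by auto
  ultimately have "skew_prod \<sigma> fs = skew_prod \<sigma> gs'" using f skew_mult_cancel_right by metis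
  moreover have "nrd_minimal (skew_prod \<sigma> fs)" using snoc.prems(1) f(1) nrd_minimal_factors by metis
  ultimately have "fs = gs'" using snoc.IH snoc.prems(3,4) all(1) by (simp add: gs)
  then show ?case using gs \<open>g = g'\<close> by simp
qed simp

section \<open>Adjusting constants to reach the norms exactly\<close>

lemma nrd_const_mult_inverse:
  assumes "u \<noteq> 0"
  shows "nrd [:u:] * nrd [:1 / u:] = 1"
proof -
  have "[:u:] \<star> [:1 / u:] = 1" using assms by (simp add: skew_mult_const_left one_pCons)
  then show ?thesis by (metis nrd_mult nrd_1)
qed

text \<open>The hypothesis on \<open>c\<close> says that \<open>h\<close> has the leading
  coefficient of the norm of a polynomial of degree \<open>degree h\<close> with leading coefficient
  \<open>c\<close>. Proportional polynomials with equal leading coefficients coincide.\<close>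

lemma nrd_scaled:
  assumes g: "lead_coeff g = 1" "proportional (nrd g) h" "h \<noteq> 0"
    and c: "\<iota> (lead_coeff h) = (- 1) ^ ((n - 1) * degree h) * galois_norm \<sigma> n c"
  shows "c \<noteq> 0" "nrd ([:c:] \<star> g) = h"
proof -
  have deg: "degree g = degree h" using proportional_degree[OF g(2)] by (simp add: degree_nrd)
  show c0: "c \<noteq> 0"
  proof
    assume "c = 0"
    then have "\<iota> (lead_coeff h) = 0" using c galois_norm_eq_0_iff[of c] by simp
    then show False using g(3) by simp
  qed
  have "nrd [:c:] \<noteq> 0" "degree (nrd [:c:]) = 0" using c0 by (simp_all add: nrd_eq_0_iff degree_nrd)
  then obtain k where k: "nrd [:c:] = [:k:]" by (metis degree_eq_zeroE)
  obtain l where l: "nrd g = Polynomial.smult l h" using g(2) by (auto simp: proportional_def)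
  have eq: "nrd ([:c:] \<star> g) = Polynomial.smult (k * l) h" by (simp add: nrd_mult k l mult.commute)
  have "g \<noteq> 0" using g(1) by auto
  then have "degree ([:c:] \<star> g) = degree h" using c0 by (simp add: degree_skew_mult deg)
  moreover have "lead_coeff ([:c:] \<star> g) = c" using g(1) unfolding lead_coeff_skew_mult by simp
  ultimately have "\<iota> (lead_coeff (nrd ([:c:] \<star> g))) = \<iota> (lead_coeff h)"
    using lead_coeff_nrd[of "[:c:] \<star> g"] c by simp
  then have "lead_coeff (nrd ([:c:] \<star> g)) = lead_coeff h" by simp
  then have "k * l * lead_coeff h = lead_coeff h" by (simp only: eq lead_coeff_smult)
  then have "k * l = 1" using g(3) by simp
  then show "nrd ([:c:] \<star> g) = h" using eq by simp
qed

text \<open>Every factor gets its own scalar. As scalars cannot pass through the product freely,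
  they are collected in a constant \<open>u\<close> at the front.\<close>

lemma exact_nrds_up_to_const:
  assumes "list_all2 (\<lambda>g h. skew_irreducible \<sigma> g \<and> lead_coeff g = 1 \<and> proportional (nrd g) h \<and> h \<noteq> 0 \<and>
      (\<exists>c. \<iota> (lead_coeff h) = (- 1) ^ ((n - 1) * degree h) * galois_norm \<sigma> n c)) gs hs"
  shows "\<exists>u fs. u \<noteq> 0 \<and> [:u:] \<star> skew_prod \<sigma> gs = skew_prod \<sigma> fs \<and>
    list_all2 (\<lambda>f h. skew_irreducible \<sigma> f \<and> nrd f = h) fs hs"
  using assms
proof (induction rule: list_all2_induct)
  case Nil
  show ?case by (intro exI[of _ 1] exI[of _ "[]"]) (simp flip: one_pCons)
next
  case (Cons g gs h hs)
  then obtain v fs where v: "v \<noteq> 0" "[:v:] \<star> skew_prod \<sigma> gs = skew_prod \<sigma> fs"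
    and fs: "list_all2 (\<lambda>f h. skew_irreducible \<sigma> f \<and> nrd f = h) fs hs" by blast
  obtain c where "\<iota> (lead_coeff h) = (- 1) ^ ((n - 1) * degree h) * galois_norm \<sigma> n c"
    using Cons(1) by blast
  then have c: "c \<noteq> 0" "nrd ([:c:] \<star> g) = h" using nrd_scaled[of g h c] Cons(1) by blast+
  \<comment> \<open>The trailing \<open>[:1 / v:]\<close> cancels the constant \<open>v\<close>
    collected by the tail. The norms of \<open>v\<close> and its inverse cancel, so
    \<open>f1\<close> has the norm of \<open>[:c:] \<star> g\<close>.\<close>
  define f1 where "f1 = [:v * c:] \<star> g \<star> [:1 / v:]"
  have vc: "[:v * c:] = [:v:] \<star> [:c:]" by (simp add: skew_mult_const_left)
  have "nrd f1 = nrd [:v:] * nrd [:1 / v:] * nrd ([:c:] \<star> g)"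
    by (simp add: f1_def vc nrd_mult)
  then have "nrd f1 = h" using c v by (simp add: nrd_const_mult_inverse)
  moreover have "skew_irreducible \<sigma> f1"
    unfolding f1_def using Cons(1) v c by (intro skew_irreducible_const_mult) auto
  moreover have "f1 \<star> skew_prod \<sigma> fs = [:v * c:] \<star> g \<star> ([:1 / v:] \<star> [:v:]) \<star> skew_prod \<sigma> gs"
    by (simp only: f1_def v(2)[symmetric] skew_mult_assoc)
  moreover have "[:1 / v:] \<star> [:v:] = 1" using v by (simp add: skew_mult_const_left one_pCons)
  ultimately show ?case
    using v c fs by (intro exI[of _ "v * c"] exI[of _ "f1 # fs"]) (simp add: skew_mult_assoc)
qed

text \<open>The remaining constant has norm 1 and can be absorbed by the first factor.\<close>

lemma exact_nrds:
  assumes gs: "list_all2 (\<lambda>g h. skew_irreducible \<sigma> g \<and> lead_coeff g = 1 \<and> proportional (nrd g) h \<and> h \<noteq> 0 \<and>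
      (\<exists>c. \<iota> (lead_coeff h) = (- 1) ^ ((n - 1) * degree h) * galois_norm \<sigma> n c)) gs hs"
    and prod: "nrd (skew_prod \<sigma> gs) = prod_list hs"
  shows "\<exists>fs. skew_prod \<sigma> gs = skew_prod \<sigma> fs \<and>
    list_all2 (\<lambda>f h. skew_irreducible \<sigma> f \<and> nrd f = h) fs hs"
proof -
  obtain u fs where u: "u \<noteq> 0" "[:u:] \<star> skew_prod \<sigma> gs = skew_prod \<sigma> fs"
    and fs: "list_all2 (\<lambda>f h. skew_irreducible \<sigma> f \<and> nrd f = h) fs hs"
    using exact_nrds_up_to_const[OF gs] by blast
  have hs0: "prod_list hs \<noteq> 0"
    using gs by (auto simp: prod_list_zero_iff in_set_conv_nth list_all2_conv_all_nth)
  have "map nrd fs = hs" using fs by (auto simp: list_all2_conv_all_nth intro!: nth_equalityI)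
  \<comment> \<open>Both products have norm \<open>prod_list hs\<close>, which leaves norm 1 for
    \<open>u\<close>.\<close>
  then have "nrd [:u:] * prod_list hs = prod_list hs"
    using arg_cong[OF u(2), of nrd] prod by (simp add: nrd_mult nrd_skew_prod)
  then have "nrd [:u:] = 1" using hs0 by simp
  then have u1: "nrd [:1 / u:] = 1" using nrd_const_mult_inverse[OF u(1)] by simp
  have prod_gs: "skew_prod \<sigma> gs = [:1 / u:] \<star> skew_prod \<sigma> fs"
    using u by (simp flip: u(2) add: skew_mult_const_left)
  show ?thesis
  proof (cases fs)
    case Nil
    then have "hs = []" using fs by simp
    then have "gs = []" using gs by simp
    then show ?thesis using Nil fs by (intro exI[of _ "[]"]) simp
  next
    case (Cons f1 fs')
    have "skew_irreducible \<sigma> f1" using fs Cons by (auto simp: list_all2_Cons1)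
    then have "skew_irreducible \<sigma> ([:1 / u:] \<star> f1 \<star> [:1:])"
      using u(1) by (intro skew_irreducible_const_mult) auto
    then have "skew_irreducible \<sigma> ([:1 / u:] \<star> f1)" by (simp flip: one_pCons)
    then show ?thesis
      using prod_gs fs u1 Cons
      by (intro exI[of _ "([:1 / u:] \<star> f1) # fs'"])
         (auto simp: skew_mult_assoc nrd_mult list_all2_Cons1)
  qed
qed

section \<open>Matching decompositions with orderings\<close>

lemma decomposition_factors:
  assumes f: "nrd_minimal f" and fs: "fs \<in> monic_irreducible_decompositions \<sigma> f"
  shows "\<forall>p\<in>set (map nrd fs). Factorial_Ring.irreducible p" "nrd f = prod_list (map nrd fs)"
  using assms irreducible_nrd nrd_minimal_skew_prod
  by (auto simp: monic_irreducible_decompositions_def nrd_skew_prod)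

lemma ordered_decomposition:
  assumes f: "nrd_minimal f" "lead_coeff f = 1"
    and hs: "\<forall>h\<in>set hs. Factorial_Ring.irreducible h" "proportional (nrd f) (prod_list hs)"
  shows "\<exists>!fs. fs \<in> monic_irreducible_decompositions \<sigma> f \<and>
    list_all2 (\<lambda>g h. proportional (nrd g) h) fs hs"
proof (rule ex_ex1I)
  show "\<exists>fs. fs \<in> monic_irreducible_decompositions \<sigma> f \<and> list_all2 (\<lambda>g h. proportional (nrd g) h) fs hs"
    using ex_decomposition[OF f hs] by blast
next
  fix fs gs
  assume fs: "fs \<in> monic_irreducible_decompositions \<sigma> f \<and> list_all2 (\<lambda>g h. proportional (nrd g) h) fs hs"
    and gs: "gs \<in> monic_irreducible_decompositions \<sigma> f \<and> list_all2 (\<lambda>g h. proportional (nrd g) h) gs hs"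
  have "list_all2 (\<lambda>g h. proportional (nrd g) (nrd h)) fs gs"
    using fs gs unfolding list_all2_conv_all_nth by (metis proportional_trans proportional_sym)
  then show "fs = gs"
    using fs gs f by (intro decomposition_unique) (auto simp: monic_irreducible_decompositions_def)
qed

text \<open>The norms of the factors are irreducible with product N(f), so unique factorization
  makes them a rearrangement of \<open>hs\<close> up to constants. As members of \<open>hs\<close>
  are pairwise not proportional, the rearrangement is determined by \<open>fs\<close>.\<close>

lemma decomposition_order:
  assumes f: "nrd_minimal f" and fs: "fs \<in> monic_irreducible_decompositions \<sigma> f"
    and hs: "\<forall>h\<in>set hs. Factorial_Ring.irreducible h" "proportional (nrd f) (prod_list hs)"
    and distinct: "\<And>i j. i < length hs \<Longrightarrow> j < length hs \<Longrightarrow> proportional (hs ! i) (hs ! j) \<Longrightarrow> i = j"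
  shows "length fs = length hs"
    and "\<exists>!\<pi>. \<pi> permutes {..<length hs} \<and> (\<forall>i<length hs. proportional (nrd (fs ! i)) (hs ! \<pi> i))"
proof -
  note fac = decomposition_factors[OF f fs]
  obtain cs where cs: "mset cs = mset hs" "list_all2 proportional (map nrd fs) cs"
    using irreducible_factorization_unique[OF fac(1) hs(1)] hs(2) fac(2) by auto
  obtain \<pi> where \<pi>: "\<pi> permutes {..<length hs}" "permute_list \<pi> hs = cs"
    using mset_eq_permutation[OF cs(1)] by blast
  show len: "length fs = length hs"
    using list_all2_lengthD[OF cs(2)] mset_eq_length[OF cs(1)] by simp
  have assoc: "proportional (nrd (fs ! i)) (hs ! \<pi> i)" if "i < length hs" for i
    using list_all2_nthD[OF cs(2), of i] permute_list_nth[OF \<pi>(1) that] \<pi>(2) that len by simp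
  show "\<exists>!\<pi>. \<pi> permutes {..<length hs} \<and> (\<forall>i<length hs. proportional (nrd (fs ! i)) (hs ! \<pi> i))"
  proof (rule ex1I[of _ \<pi>])
    show "\<pi> permutes {..<length hs} \<and> (\<forall>i<length hs. proportional (nrd (fs ! i)) (hs ! \<pi> i))"
      using \<pi>(1) assoc by blast
  next
    fix \<rho> assume \<rho>: "\<rho> permutes {..<length hs} \<and> (\<forall>i<length hs. proportional (nrd (fs ! i)) (hs ! \<rho> i))"
    show "\<rho> = \<pi>"
    proof
      fix i
      show "\<rho> i = \<pi> i"
      proof (cases "i < length hs")
        case True
        then have "proportional (hs ! \<rho> i) (hs ! \<pi> i)"
          using \<rho> assoc[OF True] proportional_sym proportional_trans[of "hs ! \<rho> i" "nrd (fs ! i)"] by blast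
        moreover have "\<rho> i < length hs" "\<pi> i < length hs"
          using True \<rho> \<pi>(1) permutes_in_image[of _ "{..<length hs}" i] by auto
        ultimately show ?thesis using distinct by blast
      next
        case False
        then show ?thesis using \<rho> \<pi>(1) by (simp add: permutes_def)
      qed
    qed
  qed
qed

text \<open>Rearranging \<open>hs\<close> does not change its product, so this is
  \<open>ordered_decomposition\<close> for the permuted list.\<close>

lemma permuted_decomposition:
  assumes f: "nrd_minimal f" "lead_coeff f = 1"
    and hs: "\<forall>h\<in>set hs. Factorial_Ring.irreducible h" "proportional (nrd f) (prod_list hs)"
    and \<pi>: "\<pi> permutes {..<length hs}"
  shows "\<exists>!fs. fs \<in> monic_irreducible_decompositions \<sigma> f \<and> length fs = length hs \<and>
    (\<forall>i<length hs. proportional (nrd (fs ! i)) (hs ! \<pi> i))"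
proof -
  have "mset (permute_list \<pi> hs) = mset hs" using \<pi> by simp
  then have "prod_list (permute_list \<pi> hs) = prod_list hs" "set (permute_list \<pi> hs) = set hs"
    by (metis prod_mset_prod_list) (metis \<open>mset (permute_list \<pi> hs) = mset hs\<close> mset_eq_setD)
  then have "\<exists>!fs. fs \<in> monic_irreducible_decompositions \<sigma> f \<and>
      list_all2 (\<lambda>g h. proportional (nrd g) h) fs (permute_list \<pi> hs)"
    using f hs by (intro ordered_decomposition) auto
  moreover have "list_all2 (\<lambda>g h. proportional (nrd g) h) fs (permute_list \<pi> hs) \<longleftrightarrow>
      length fs = length hs \<and> (\<forall>i<length hs. proportional (nrd (fs ! i)) (hs ! \<pi> i))" for fs
    using permute_list_nth[OF \<pi>] unfolding list_all2_conv_all_nth length_permute_list by metis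
  ultimately show ?thesis by (simp only:)
qed

text \<open>Each p(t^n) with p over F is central and so competes with h(t^n). Degrees in t are
  \<open>n\<close> times those in x, and \<open>degree h = degree f\<close> turns the comparison
  into the required bound.\<close>

lemma nrd_minimal_if_min_central_left_multiple:
  assumes f: "f \<noteq> 0" and h: "min_central_left_multiple \<sigma> f (eval_at_tn \<iota> n h)" "degree h = degree f"
  shows "nrd_minimal f"
  unfolding nrd_minimal_def
proof (intro conjI f allI impI, elim conjE)
  fix p assume p: "p \<noteq> 0" "right_divides \<sigma> f (eval_at_tn \<iota> n p)"
  have "eval_at_tn \<iota> n p \<in> skew_center \<sigma>" by (simp add: skew_center_def eval_at_tn_commute)
  then have "degree (eval_at_tn \<iota> n h) \<le> degree (eval_at_tn \<iota> n p)"
    using h(1) p unfolding min_central_left_multiple_def by (simp add: eval_at_tn_eq_0_iff)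
  then show "degree f \<le> degree p" using n_pos h(2) by (simp add: degree_eval_at_tn)
qed

end

text \<open>Such a relation is the graph of a bijection. Used with permutations on one side and
  decompositions on the other.\<close>

lemma card_eq_if_ex1:
  assumes "\<And>a. a \<in> A \<Longrightarrow> \<exists>!b. b \<in> B \<and> R a b" "\<And>b. b \<in> B \<Longrightarrow> \<exists>!a. a \<in> A \<and> R a b"
  shows "card A = card B"
proof -
  define g where "g a = (THE b. b \<in> B \<and> R a b)" for a
  have g: "g a \<in> B \<and> R a (g a)" if "a \<in> A" for a
    unfolding g_def by (rule theI') (rule assms(1)[OF that])
  have "inj_on g A" using g assms(2) by (metis inj_onI)
  moreover have "g ` A = B"
  proof (intro equalityI subsetI)
    fix b assume b: "b \<in> B"
    then obtain a where "a \<in> A" "R a b" using assms(2) by blast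
    then show "b \<in> g ` A" using g assms(1) b by (metis imageI)
  qed (use g in auto)
  ultimately show ?thesis using card_image[of g A] by simp
qed

text \<open>Leading coefficients of norms are signs times Galois norms, whence the constants
  \<open>c\<close>: exact norms are claimed when all prescribed leading coefficients have that
  shape. Counting monic factors identifies decompositions that differ by moving units.\<close>

theorem corollary7:
  fixes \<iota> :: "'f::field \<Rightarrow> 'k::field"
    and \<sigma> :: "'k \<Rightarrow> 'k"
    and n m :: nat
    and f :: "'k poly"
    and hhat :: "'f poly"
  assumes "cyclic_galois_extension \<iota> \<sigma> n"
    and "degree f = m"
    and "lead_coeff f = 1"
    and "is_gcrd \<sigma> f (monom 1 1) 1"
    and "lead_coeff hhat = 1"
    and "min_central_left_multiple \<sigma> f (eval_at_tn \<iota> n hhat)"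
    and "degree hhat = m"
  shows
    "(\<forall>hs :: 'f poly list.
       skew_norm \<iota> \<sigma> n f = prod_list hs \<and> (\<forall>h\<in>set hs. Factorial_Ring.irreducible h) \<longrightarrow>
       (\<exists>fs. length fs = length hs \<and> f = skew_prod \<sigma> fs \<and>
          (\<forall>i<length hs. skew_irreducible \<sigma> (fs ! i) \<and>
             degree (fs ! i) = degree (hs ! i) \<and>
             (\<exists>c. c \<noteq> 0 \<and> skew_norm \<iota> \<sigma> n (fs ! i) = Polynomial.smult c (hs ! i))) \<and>
          ((\<forall>i<length hs. \<exists>c. \<iota> (lead_coeff (hs ! i)) =
               (- 1) ^ ((n - 1) * degree (hs ! i)) * galois_norm \<sigma> n c) \<longrightarrow>
             (\<forall>i<length hs. skew_norm \<iota> \<sigma> n (fs ! i) = hs ! i))))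
     \<and>
     (\<forall>hs :: 'f poly list.
       skew_norm \<iota> \<sigma> n f = prod_list hs \<and> (\<forall>h\<in>set hs. Factorial_Ring.irreducible h) \<and>
       (\<forall>i<length hs. \<forall>j<length hs. i \<noteq> j \<longrightarrow> \<not> (\<exists>c. hs ! i = Polynomial.smult c (hs ! j))) \<longrightarrow>
       card (monic_irreducible_decompositions \<sigma> f) = fact (length hs) \<and>
       (\<forall>\<pi>. \<pi> permutes {..<length hs} \<longrightarrow>
          (\<exists>!fs. fs \<in> monic_irreducible_decompositions \<sigma> f \<and> length fs = length hs \<and>
             (\<forall>i<length hs. \<exists>c. c \<noteq> 0 \<and>
                skew_norm \<iota> \<sigma> n (fs ! i) = Polynomial.smult c (hs ! \<pi> i)))) \<and>
       (\<forall>fs\<in>monic_irreducible_decompositions \<sigma> f. length fs = length hs \<and>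
          (\<exists>!\<pi>. \<pi> permutes {..<length hs} \<and>
             (\<forall>i<length hs. \<exists>c. c \<noteq> 0 \<and>
                skew_norm \<iota> \<sigma> n (fs ! i) = Polynomial.smult c (hs ! \<pi> i)))))"
proof -
  interpret cyclic_algebra \<iota> \<sigma> n by unfold_locales fact
  have "f \<noteq> 0" using assms(3) by auto
  then have f: "nrd_minimal f"
    using nrd_minimal_if_min_central_left_multiple assms(2,6,7) by blast
  show ?thesis
  \<comment> \<open>Goal 1 is part (i). For part (ii), goal 2 is the count, goal 3 the decomposition
    for each ordering, and goal 4 the ordering of each decomposition.\<close>
  proof (intro conjI allI impI, goal_cases)
    case (1 hs)
    then have hs: "nrd f = prod_list hs" "\<forall>h\<in>set hs. Factorial_Ring.irreducible h" by auto
    obtain gs where gs: "gs \<in> monic_irreducible_decompositions \<sigma> f"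
        "list_all2 (\<lambda>g h. proportional (nrd g) h) gs hs"
      using ex_decomposition[OF f assms(3) hs(2)] hs(1) proportional_refl by auto
    have len: "length gs = length hs" using gs(2) by (rule list_all2_lengthD)
    have f_gs: "f = skew_prod \<sigma> gs" using gs(1) by (simp add: monic_irreducible_decompositions_def)
    have irr: "skew_irreducible \<sigma> (gs ! i)" "lead_coeff (gs ! i) = 1"
      and assoc: "proportional (nrd (gs ! i)) (hs ! i)" if "i < length hs" for i
      using gs that len by (auto simp: monic_irreducible_decompositions_def list_all2_conv_all_nth)
    have deg: "degree g = degree h" if "proportional (nrd g) h" for g h
      using proportional_degree[OF that] by (simp add: degree_nrd)
    let ?exact = "\<forall>i<length hs. \<exists>c. \<iota> (lead_coeff (hs ! i)) =
        (- 1) ^ ((n - 1) * degree (hs ! i)) * galois_norm \<sigma> n c"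
    have "\<exists>fs. length fs = length hs \<and> f = skew_prod \<sigma> fs \<and>
        (\<forall>i<length hs. skew_irreducible \<sigma> (fs ! i) \<and> proportional (nrd (fs ! i)) (hs ! i)) \<and>
        (?exact \<longrightarrow> (\<forall>i<length hs. nrd (fs ! i) = hs ! i))"
    \<comment> \<open>If all prescribed leading coefficients are attainable, the monic factors are
      rescaled to exact norms; otherwise the monic decomposition itself serves.\<close>
    proof (cases ?exact)
      case True
      have "list_all2 (\<lambda>g h. skew_irreducible \<sigma> g \<and> lead_coeff g = 1 \<and> proportional (nrd g) h \<and> h \<noteq> 0 \<and>
          (\<exists>c. \<iota> (lead_coeff h) = (- 1) ^ ((n - 1) * degree h) * galois_norm \<sigma> n c)) gs hs"
        unfolding list_all2_conv_all_nth
      proof (intro conjI allI impI len)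
        fix i assume "i < length gs"
        then have i: "i < length hs" using len by simp
        show "skew_irreducible \<sigma> (gs ! i)" "lead_coeff (gs ! i) = 1" "proportional (nrd (gs ! i)) (hs ! i)"
          using irr[OF i] assoc[OF i] by auto
        show "hs ! i \<noteq> 0" using hs(2) i nth_mem by fastforce
        show "\<exists>c. \<iota> (lead_coeff (hs ! i)) = (- 1) ^ ((n - 1) * degree (hs ! i)) * galois_norm \<sigma> n c"
          using True i by blast
      qed
      then obtain fs where "f = skew_prod \<sigma> fs"
          "list_all2 (\<lambda>f h. skew_irreducible \<sigma> f \<and> nrd f = h) fs hs"
        using exact_nrds[of gs hs] hs(1) f_gs by auto
      then show ?thesis
        by (intro exI[of _ fs]) (auto simp: list_all2_conv_all_nth proportional_refl)
    next
      case False
      then show ?thesis using len f_gs irr assoc by blast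
    qed
    then obtain fs where fs: "length fs = length hs" "f = skew_prod \<sigma> fs"
        "\<forall>i<length hs. skew_irreducible \<sigma> (fs ! i) \<and> proportional (nrd (fs ! i)) (hs ! i)"
        "?exact \<longrightarrow> (\<forall>i<length hs. nrd (fs ! i) = hs ! i)" by blast
    have "\<forall>i<length hs. skew_irreducible \<sigma> (fs ! i) \<and> degree (fs ! i) = degree (hs ! i) \<and>
        (\<exists>c. c \<noteq> 0 \<and> nrd (fs ! i) = Polynomial.smult c (hs ! i))"
      using fs(3) deg unfolding proportional_def by blast
    then show ?case using fs(1,2,4) by (intro exI[of _ fs] conjI)
  next
    case (2 hs)
    then have hs: "proportional (nrd f) (prod_list hs)" "\<forall>h\<in>set hs. Factorial_Ring.irreducible h"
      using proportional_refl by auto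
    have distinct: "i = j" if "i < length hs" "j < length hs" "proportional (hs ! i) (hs ! j)" for i j
      by (rule proportional_nth_eq[OF 2[THEN conjunct2, THEN conjunct2] that])
    let ?D = "monic_irreducible_decompositions \<sigma> f"
    note dec = decomposition_order[OF f _ hs(2) hs(1) distinct]
    \<comment> \<open>A permutation and a decomposition are related when the norms of the factors
      are \<open>hs\<close> in the permuted order, up to constants; each has exactly one
      partner.\<close>
    have "card {\<pi>. \<pi> permutes {..<length hs}} = card ?D"
    proof (rule card_eq_if_ex1)
      fix \<pi> assume "\<pi> \<in> {\<pi>. \<pi> permutes {..<length hs}}"
      then have "\<pi> permutes {..<length hs}" by simp
      note permuted_decomposition[OF f assms(3) hs(2,1) this]
      moreover have "fs \<in> ?D \<and> length fs = length hs \<and> P \<longleftrightarrow> fs \<in> ?D \<and> P" for fs P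
        using dec(1) by blast
      ultimately show "\<exists>!fs. fs \<in> ?D \<and> (\<forall>i<length hs. proportional (nrd (fs ! i)) (hs ! \<pi> i))"
        by (simp only:)
    next
      fix fs assume "fs \<in> ?D"
      from dec(2)[OF this] show "\<exists>!\<pi>. \<pi> \<in> {\<pi>. \<pi> permutes {..<length hs}} \<and>
          (\<forall>i<length hs. proportional (nrd (fs ! i)) (hs ! \<pi> i))"
        by (simp only: mem_Collect_eq)
    qed
    then show ?case by (simp add: card_permutations)
  next
    case (3 hs \<pi>)
    then have hs: "proportional (nrd f) (prod_list hs)" "\<forall>h\<in>set hs. Factorial_Ring.irreducible h"
      using proportional_refl by auto
    from permuted_decomposition[OF f assms(3) hs(2,1) 3(2)] show ?case
      unfolding proportional_def .
  next
    case (4 hs)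
    then have hs: "proportional (nrd f) (prod_list hs)" "\<forall>h\<in>set hs. Factorial_Ring.irreducible h"
      using proportional_refl by auto
    have distinct: "i = j" if "i < length hs" "j < length hs" "proportional (hs ! i) (hs ! j)" for i j
      by (rule proportional_nth_eq[OF 4[THEN conjunct2, THEN conjunct2] that])
    show ?case
    proof (intro ballI conjI)
      fix fs assume "fs \<in> monic_irreducible_decompositions \<sigma> f"
      note dec = decomposition_order[OF f this hs(2) hs(1) distinct]
      show "length fs = length hs" by (rule dec(1))
      show "\<exists>!\<pi>. \<pi> permutes {..<length hs} \<and> (\<forall>i<length hs. \<exists>c. c \<noteq> 0 \<and>
          nrd (fs ! i) = Polynomial.smult c (hs ! \<pi> i))"
        using dec(2) unfolding proportional_def .
    qed
  qed
qed

end
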